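(* Let $S$ be a topological semigroup, $\varphi\in\Delta_S(S)$, and $P(\varphi)=\{s\in S:\varphi(s)=1\}$, a topological subsemigroup of $S$. Then the following assertions are equivalent: (i) there is a bounded linear functional $m\in RUC(P(\varphi))^*$ such that $m(\varphi)=1$ (where $\varphi$ is restricted to $P(\varphi)$) and $m(f\cdot s)=m(f)$ for all $f\in RUC(P(\varphi))$ and $s\in P(\varphi)$; (ii) for every continuous affine action of $P(\varphi)$ on a nonempty compact convex subset $Y$ of a locally convex linear topological space, $Y$ contains a common fixed point of $P(\varphi)$.
   Context: A character on a topological semigroup $S$ is a nonzero continuous map $\varphi:S\to\mathbb{T}$ (the unit circle) with $\varphi(st)=\varphi(s)\varphi(t)$ for all $s,t$; $\Delta_S(S)$ is the set of characters. For a topological semigroup $P$ and a bounded continuous function $f:P\to\mathbb{C}$, put $(f\cdot s)(t)=f(st)$ for $s,t\in P$; $RUC(P)$ is the Banach algebra (sup norm) of bounded continuous $f$ with $\|f\cdot s_\alpha-f\cdot s\|_\infty\to0$ whenever $s_\alpha\to s$ in $P$. A continuous affine action of $P$ on a compact convex set $Y$ is a jointly continuous map $P\times Y\to Y$, $(s,y)\mapsto sy$, with $(st)y=s(ty)$ and $y\mapsto sy$ affine for each $s\in P$. A common fixed point is $y\in Y$ with $sy=y$ for all $s\in P$. *)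

theory Defs
  imports "HOL-Analysis.Analysis" "HOL-Algebra.Algebraic_Closure_Type"
begin

definition semigroup_character :: "('a::topological_semigroup_mult \<Rightarrow> complex) \<Rightarrow> bool" where
  "semigroup_character \<phi> \<longleftrightarrow>
     continuous_on UNIV \<phi> \<and> range \<phi> \<subseteq> sphere 0 1 \<and> (\<exists>s. \<phi> s \<noteq> 0) \<and>
     (\<forall>s t. \<phi> (s * t) = \<phi> s * \<phi> t)"

definition unit_fibre :: "('a \<Rightarrow> complex) \<Rightarrow> 'a set" where
  "unit_fibre \<phi> = {s. \<phi> s = 1}"

text \<open>
  A subset \<open>P\<close> closed under multiplication is regarded as a topological semigroup with the
  subspace topology. A function \<open>P \<rightarrow> \<complex>\<close> is represented by the total function
  that agrees with it on \<open>P\<close> and is \<open>0\<close> elsewhere, so that equality of functions on \<open>P\<close> is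
  equality in HOL and the pointwise operations are the vector space operations.
\<close>

definition restrict_zero :: "'a set \<Rightarrow> ('a \<Rightarrow> complex) \<Rightarrow> 'a \<Rightarrow> complex" where
  "restrict_zero P f = (\<lambda>t. if t \<in> P then f t else 0)"

definition translate :: "'a::times set \<Rightarrow> ('a \<Rightarrow> complex) \<Rightarrow> 'a \<Rightarrow> 'a \<Rightarrow> complex" where
  "translate P f s = restrict_zero P (\<lambda>t. f (s * t))"

definition sup_norm :: "'a set \<Rightarrow> ('a \<Rightarrow> complex) \<Rightarrow> real" where
  "sup_norm P f = (SUP t\<in>P. norm (f t))"

text \<open>
  The last clause says that \<open>s \<mapsto> f \<cdot> s\<close> is continuous from \<open>P\<close> to the sup norm. It covers all nets
  in \<open>P\<close> converging to \<open>s\<close>, including those that take the value \<open>s\<close>, because the quantity under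
  the limit vanishes at \<open>u = s\<close>.
\<close>

definition RUC :: "'a::topological_semigroup_mult set \<Rightarrow> ('a \<Rightarrow> complex) set" where
  "RUC P = {f. (\<forall>t. t \<notin> P \<longrightarrow> f t = 0) \<and> continuous_on P f \<and> bounded (f ` P) \<and>
     (\<forall>s\<in>P. ((\<lambda>u. sup_norm P (\<lambda>t. translate P f u t - translate P f s t)) \<longlongrightarrow> 0) (at s within P))}"

text \<open>Only the values of \<open>m\<close> on \<open>RUC P\<close> matter.\<close>

definition RUC_functional ::
    "'a::topological_semigroup_mult set \<Rightarrow> (('a \<Rightarrow> complex) \<Rightarrow> complex) \<Rightarrow> bool" where
  "RUC_functional P m \<longleftrightarrow>
     (\<forall>f\<in>RUC P. \<forall>g\<in>RUC P. m (\<lambda>t. f t + g t) = m f + m g) \<and>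
     (\<forall>c. \<forall>f\<in>RUC P. m (\<lambda>t. c * f t) = c * m f) \<and>
     (\<exists>K. \<forall>f\<in>RUC P. norm (m f) \<le> K * sup_norm P f)"

definition translation_invariant ::
    "'a::topological_semigroup_mult set \<Rightarrow> (('a \<Rightarrow> complex) \<Rightarrow> complex) \<Rightarrow> bool" where
  "translation_invariant P m \<longleftrightarrow> (\<forall>f\<in>RUC P. \<forall>s\<in>P. m (translate P f s) = m f)"

text \<open>
  The vector space is given by a carrier set inside a type and its own operations and topology, so
  that a quantifier over \<open>V\<close> and \<open>T\<close> ranges over all locally convex spaces whose underlying set lies
  in the type. Scalars are real; this includes complex spaces, by restriction of scalars. Locally
  convex spaces are Hausdorff by convention: on an indiscrete line, the translations by integers
  are continuous and affine on a compact convex set and have no fixed point.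
\<close>

definition segment_point :: "(real, 'v) module \<Rightarrow> real \<Rightarrow> 'v \<Rightarrow> 'v \<Rightarrow> 'v" where
  "segment_point V a x y = (1 - a) \<odot>\<^bsub>V\<^esub> x \<oplus>\<^bsub>V\<^esub> a \<odot>\<^bsub>V\<^esub> y"

definition convex_in :: "(real, 'v) module \<Rightarrow> 'v set \<Rightarrow> bool" where
  "convex_in V C \<longleftrightarrow> C \<subseteq> carrier V \<and> (\<forall>x\<in>C. \<forall>y\<in>C. \<forall>a\<in>{0..1}. segment_point V a x y \<in> C)"

locale locally_convex_space =
  Module.module "ring_of_type_algebra :: real ring" V for V :: "(real, 'v) module" (structure) +
  fixes T :: "'v topology"
  assumes topspace_eq: "topspace T = carrier V"
    and Hausdorff: "Hausdorff_space T"
    and continuous_add: "continuous_map (prod_topology T T) T (\<lambda>(x, y). x \<oplus>\<^bsub>V\<^esub> y)"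
    and continuous_smult: "continuous_map (prod_topology euclideanreal T) T (\<lambda>(a, x). a \<odot>\<^bsub>V\<^esub> x)"
    and locally_convex:
      "\<And>U. openin T U \<Longrightarrow> \<zero>\<^bsub>V\<^esub> \<in> U \<Longrightarrow> \<exists>W. openin T W \<and> \<zero>\<^bsub>V\<^esub> \<in> W \<and> W \<subseteq> U \<and> convex_in V W"

definition continuous_affine_action ::
    "'a::topological_semigroup_mult set \<Rightarrow> (real, 'v) module \<Rightarrow> 'v topology \<Rightarrow> 'v set \<Rightarrow>
     ('a \<Rightarrow> 'v \<Rightarrow> 'v) \<Rightarrow> bool" where
  "continuous_affine_action P V T Y act \<longleftrightarrow>
     continuous_map (prod_topology (top_of_set P) (subtopology T Y)) (subtopology T Y)
       (\<lambda>(s, y). act s y) \<and>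
     (\<forall>s\<in>P. \<forall>t\<in>P. \<forall>y\<in>Y. act (s * t) y = act s (act t y)) \<and>
     (\<forall>s\<in>P. \<forall>x\<in>Y. \<forall>y\<in>Y. \<forall>a\<in>{0..1}.
        act s (segment_point V a x y) = segment_point V a (act s x) (act s y))"

text \<open>
  A formula cannot quantify over types, so the type containing the spaces is a parameter. The type
  \<open>('a \<Rightarrow> complex) \<Rightarrow> complex\<close> is large enough to contain the weak-* dual of \<open>RUC P\<close>, so an
  equivalence for that type together with an implication into every type \<open>'v\<close> amounts to an
  equivalence with the property for all locally convex spaces.
\<close>

definition fixed_point_property :: "'v itself \<Rightarrow> 'a::topological_semigroup_mult set \<Rightarrow> bool" where
  "fixed_point_property _ P \<longleftrightarrow>
     (\<forall>(V :: (real, 'v) module) T Y act.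
        locally_convex_space V T \<and> convex_in V Y \<and> compactin T Y \<and> Y \<noteq> {} \<and>
        continuous_affine_action P V T Y act
        \<longrightarrow> (\<exists>y\<in>Y. \<forall>s\<in>P. act s y = y))"

end

theory Submission
  imports Defs
begin

text \<open>
  On \<open>P = P(\<phi>)\<close> the character is constantly \<open>1\<close>, so the condition \<open>m(\<phi>) = 1\<close> says \<open>m(1) = 1\<close>, and the
  equivalence is a version of Day's fixed point theorem for an arbitrary topological semigroup \<open>P\<close>.

  From a functional to fixed points. The functional \<open>m\<close> need not be positive. On real functions
  its real part has a positive part \<open>f \<mapsto> sup {Re (m g) | 0 \<le> g \<le> f}\<close>, and this is again translation
  invariant: translation maps \<open>{g. 0 \<le> g \<le> f}\<close> into \<open>{g. 0 \<le> g \<le> f \<cdot> s}\<close>, which gives one inequality,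
  and for \<open>f \<le> 1\<close> the same inequality for \<open>1 - f\<close> gives the other one (\<open>sup_below_invariant\<close>). Normalising yields
  an invariant mean \<open>M\<close>. Given an action on \<open>Y\<close> and \<open>y0 \<in> Y\<close>, every continuous affine \<open>h\<close> on \<open>Y\<close> gives
  a function \<open>t \<mapsto> h (t y0)\<close>, which lies in \<open>RUC P\<close> by the tube lemma, and \<open>M\<close> of it is a positive
  normalised functional of \<open>h\<close>. Such a functional is evaluation at a point \<open>y\<close> (\<open>barycenter\<close>).
  Invariance of \<open>M\<close> says \<open>h (s y) = h y\<close> for all affine \<open>h\<close>, and these separate the points of \<open>Y\<close> by the
  Hahn-Banach theorem (\<open>separating_functional\<close>), so \<open>s y = y\<close>.

  From fixed points to a functional. The unital contractions of \<open>RUC P\<close> into \<open>\<complex>\<close> form a convex set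
  that is compact in the topology of pointwise convergence by Tychonoff's theorem, and
  \<open>(s m)(f) = m (f \<cdot> s)\<close> is an affine action on it. Joint continuity is where right uniform continuity
  enters: \<open>\<bar>m (f \<cdot> u) - m (f \<cdot> s)\<bar> \<le> \<parallel>f \<cdot> u - f \<cdot> s\<parallel>\<close> uniformly in \<open>m\<close>. A fixed point is an invariant
  functional.
\<close>

section \<open>Right uniformly continuous functions\<close>

definition subsemigroup :: "'a::times set \<Rightarrow> bool" where
  "subsemigroup P \<longleftrightarrow> P \<noteq> {} \<and> (\<forall>s\<in>P. \<forall>t\<in>P. s * t \<in> P)"

lemma sup_norm_le_iff:
  assumes "P \<noteq> {}" "bounded (f ` P)"
  shows "sup_norm P f \<le> e \<longleftrightarrow> (\<forall>t\<in>P. norm (f t) \<le> e)"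
proof -
  have "bdd_above ((\<lambda>t. norm (f t)) ` P)"
    using assms(2) by (auto simp: bounded_iff bdd_above_def)
  then show ?thesis
    unfolding sup_norm_def using assms(1) by (simp add: cSUP_le_iff)
qed

lemma sup_norm_nonneg:
  assumes "P \<noteq> {}" "bounded (f ` P)"
  shows "0 \<le> sup_norm P f"
proof -
  obtain t where "t \<in> P"
    using assms(1) by blast
  then have "norm (f t) \<le> sup_norm P f"
    using sup_norm_le_iff[OF assms, of "sup_norm P f"] by blast
  then show ?thesis
    using norm_ge_zero order_trans by blast
qed

lemma norm_le_sup_norm:
  assumes "t \<in> P" "bounded (f ` P)"
  shows "norm (f t) \<le> sup_norm P f"
  using sup_norm_le_iff[of P f "sup_norm P f"] assms by blast

lemma sup_norm_translate_diff_le_iff: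
  assumes P: "subsemigroup P" and f: "bounded (f ` P)" and "u \<in> P" "s \<in> P"
  shows "sup_norm P (\<lambda>t. translate P f u t - translate P f s t) \<le> e \<longleftrightarrow>
     (\<forall>t\<in>P. norm (f (u * t) - f (s * t)) \<le> e)"
    and "0 \<le> sup_norm P (\<lambda>t. translate P f u t - translate P f s t)"
proof -
  obtain B where B: "\<And>t. t \<in> P \<Longrightarrow> norm (f t) \<le> B"
    using f by (auto simp: bounded_iff)
  have ne: "P \<noteq> {}" and cl: "\<And>s t. s \<in> P \<Longrightarrow> t \<in> P \<Longrightarrow> s * t \<in> P"
    using P by (auto simp: subsemigroup_def)
  have "norm (f (u * t) - f (s * t)) \<le> B + B" if "t \<in> P" for t
    using norm_triangle_ineq4[of "f (u * t)" "f (s * t)"] B[OF cl[OF \<open>u \<in> P\<close> that]]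
      B[OF cl[OF \<open>s \<in> P\<close> that]] by linarith
  then have b: "bounded ((\<lambda>t. translate P f u t - translate P f s t) ` P)"
    by (auto simp: bounded_iff translate_def restrict_zero_def)
  show "sup_norm P (\<lambda>t. translate P f u t - translate P f s t) \<le> e \<longleftrightarrow>
     (\<forall>t\<in>P. norm (f (u * t) - f (s * t)) \<le> e)"
    using sup_norm_le_iff[OF ne b, of e] by (simp add: translate_def restrict_zero_def)
  show "0 \<le> sup_norm P (\<lambda>t. translate P f u t - translate P f s t)"
    using sup_norm_nonneg[OF ne b] .
qed

text \<open>
  The limit in the sup norm becomes a statement about neighbourhoods that include the point \<open>s\<close>
  itself, since the sup norm vanishes there. In this form it can be pulled back along multiplication.
\<close>

lemma RUC_iff:
  fixes f :: "'a::topological_semigroup_mult \<Rightarrow> complex"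
  assumes P: "subsemigroup P"
  shows "f \<in> RUC P \<longleftrightarrow> (\<forall>t. t \<notin> P \<longrightarrow> f t = 0) \<and> continuous_on P f \<and> bounded (f ` P) \<and>
     (\<forall>s\<in>P. \<forall>e>0. \<exists>U. open U \<and> s \<in> U \<and>
        (\<forall>u\<in>U \<inter> P. \<forall>t\<in>P. norm (f (u * t) - f (s * t)) \<le> e))"
proof -
  have "((\<lambda>u. sup_norm P (\<lambda>t. translate P f u t - translate P f s t)) \<longlongrightarrow> 0) (at s within P)
     \<longleftrightarrow> (\<forall>e>0. \<exists>U. open U \<and> s \<in> U \<and>
        (\<forall>u\<in>U \<inter> P. \<forall>t\<in>P. norm (f (u * t) - f (s * t)) \<le> e))"
    (is "(?d \<longlongrightarrow> 0) _ \<longleftrightarrow> ?R")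
    if f: "bounded (f ` P)" and s: "s \<in> P" for s
  proof -
    note d = sup_norm_translate_diff_le_iff[OF P f _ s]
    have *: "(\<forall>\<^sub>F u in at s within P. ?d u < e) \<longleftrightarrow>
        (\<exists>U. open U \<and> s \<in> U \<and> (\<forall>u\<in>U \<inter> P. ?d u < e))" if "e > 0" for e
    proof -
      have "?d s < e"
        using that P by (simp add: sup_norm_def subsemigroup_def)
      then show ?thesis
        unfolding eventually_at_topological by (metis IntD1 IntD2 IntI)
    qed
    have "(?d \<longlongrightarrow> 0) (at s within P) \<longleftrightarrow> (\<forall>e>0. \<forall>\<^sub>F u in at s within P. ?d u < e)"
    proof -
      have "(\<forall>\<^sub>F u in at s within P. dist (?d u) 0 < e) \<longleftrightarrow> (\<forall>\<^sub>F u in at s within P. ?d u < e)" for e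
        by (rule eventually_cong[of "\<lambda>u. u \<in> P"])
          (use d(2) in \<open>auto simp: eventually_at_topological dist_real_def\<close>)
      then show ?thesis
        by (simp add: tendsto_iff)
    qed
    also have "\<dots> \<longleftrightarrow> (\<forall>e>0. \<exists>U. open U \<and> s \<in> U \<and> (\<forall>u\<in>U \<inter> P. ?d u < e))"
      by (rule all_cong1, rule imp_cong, rule refl, rule *)
    also have "\<dots> \<longleftrightarrow> (\<forall>e>0. \<exists>U. open U \<and> s \<in> U \<and> (\<forall>u\<in>U \<inter> P. ?d u \<le> e))"
    proof safe
      fix e :: real
      assume *: "\<forall>e>0. \<exists>U. open U \<and> s \<in> U \<and> (\<forall>u\<in>U \<inter> P. ?d u \<le> e)" and "e > 0"
      then obtain U where "open U" "s \<in> U" "\<forall>u\<in>U \<inter> P. ?d u \<le> e/2"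
        by (meson half_gt_zero)
      then show "\<exists>U. open U \<and> s \<in> U \<and> (\<forall>u\<in>U \<inter> P. ?d u < e)"
        using \<open>e > 0\<close> by (intro exI[of _ U]) (smt (verit) field_sum_of_halves)
    qed (meson less_imp_le)
    also have "\<dots> \<longleftrightarrow> ?R"
      using d(1) by (meson IntD2)
    finally show ?thesis .
  qed
  then show ?thesis
    unfolding RUC_def by auto
qed

lemma RUC_neighbourhood:
  assumes P: "subsemigroup P" and f: "f \<in> RUC P" and s: "s \<in> P" and e: "e > 0"
  obtains U where "open U" "s \<in> U"
    "\<And>u t. u \<in> U \<Longrightarrow> u \<in> P \<Longrightarrow> t \<in> P \<Longrightarrow> norm (f (u * t) - f (s * t)) \<le> e"
proof -
  have "\<exists>U. open U \<and> s \<in> U \<and> (\<forall>u\<in>U \<inter> P. \<forall>t\<in>P. norm (f (u * t) - f (s * t)) \<le> e)"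
    using f s e by (simp add: RUC_iff[OF P])
  then show thesis
    using that by blast
qed

text \<open>
  Since \<open>(f \<cdot> s)(u t) = f ((s u) t)\<close>, a neighbourhood that works for \<open>f\<close> at \<open>s r\<close> pulls back along
  \<open>u \<mapsto> s u\<close> to one that works for \<open>f \<cdot> s\<close> at \<open>r\<close>.
\<close>

lemma RUC_translate:
  fixes f :: "'a::topological_semigroup_mult \<Rightarrow> complex"
  assumes P: "subsemigroup P" and f: "f \<in> RUC P" and s: "s \<in> P"
  shows "translate P f s \<in> RUC P"
proof -
  have cl: "\<And>s t. s \<in> P \<Longrightarrow> t \<in> P \<Longrightarrow> s * t \<in> P"
    using P by (auto simp: subsemigroup_def)
  have mult: "continuous_on A (\<lambda>t. s * t)" for A
    unfolding continuous_on_def by (intro ballI tendsto_mult_left tendsto_ident_at)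
  have "continuous_on P f" "bounded (f ` P)"
    using f by (auto simp: RUC_iff[OF P])
  then have "continuous_on P (translate P f s)"
    using continuous_on_compose2[OF \<open>continuous_on P f\<close> mult] cl s
    by (auto simp: translate_def restrict_zero_def cong: continuous_on_cong)
  moreover have "translate P f s ` P \<subseteq> f ` P"
    using cl s by (auto simp: translate_def restrict_zero_def)
  then have "bounded (translate P f s ` P)"
    using \<open>bounded (f ` P)\<close> bounded_subset by blast
  moreover have "\<exists>U. open U \<and> r \<in> U \<and> (\<forall>u\<in>U \<inter> P. \<forall>t\<in>P.
      norm (translate P f s (u * t) - translate P f s (r * t)) \<le> e)" if "r \<in> P" "e > 0" for r e
  proof -
    from RUC_neighbourhood[OF P f cl[OF s \<open>r \<in> P\<close>] \<open>e > 0\<close>]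
    obtain U where U: "open U" "s * r \<in> U"
        "\<And>u t. u \<in> U \<Longrightarrow> u \<in> P \<Longrightarrow> t \<in> P \<Longrightarrow> norm (f (u * t) - f (s * r * t)) \<le> e"
      by blast
    have "open ((\<lambda>t. s * t) -` U)"
      using mult[of UNIV] U(1) continuous_on_open_vimage[of UNIV "\<lambda>t. s * t"] by auto
    then show ?thesis
      using U(2) U(3)[OF _ cl[OF s], unfolded mult.assoc] cl s \<open>r \<in> P\<close>
      by (intro exI[of _ "(\<lambda>t. s * t) -` U"])
        (auto simp: translate_def restrict_zero_def mult.assoc)
  qed
  ultimately show ?thesis
    by (auto simp: RUC_iff[OF P] translate_def restrict_zero_def)
qed

text \<open>
  A Lipschitz operation applied pointwise preserves all the defining estimates. The vector space
  and lattice operations are instances.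
\<close>

lemma RUC_pointwise:
  fixes f g :: "'a::topological_semigroup_mult \<Rightarrow> complex"
  assumes P: "subsemigroup P" and f: "f \<in> RUC P" and g: "g \<in> RUC P"
    and F0: "F 0 0 = 0" and K: "K > 0"
    and lip: "\<And>a b c d. norm (F a b - F c d) \<le> K * norm (a - c) + K * norm (b - d)"
  shows "(\<lambda>t. F (f t) (g t)) \<in> RUC P"
proof -
  have cont: "isCont (\<lambda>p. F (fst p) (snd p)) p" for p :: "complex \<times> complex"
  proof -
    have "((\<lambda>q. K * norm (fst q - fst p) + K * norm (snd q - snd p)) \<longlongrightarrow>
        K * norm (fst p - fst p) + K * norm (snd p - snd p)) (at p)"
      by (intro tendsto_add tendsto_mult tendsto_const tendsto_norm tendsto_diff
          tendsto_fst tendsto_snd tendsto_ident_at)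
    then have "((\<lambda>q. K * norm (fst q - fst p) + K * norm (snd q - snd p)) \<longlongrightarrow> 0) (at p)"
      by simp
    then have "((\<lambda>q. F (fst q) (snd q) - F (fst p) (snd p)) \<longlongrightarrow> 0) (at p)"
      by (rule Lim_null_comparison[OF always_eventually[OF allI[OF lip]]])
    then show ?thesis
      by (simp add: isCont_def LIM_zero_iff)
  qed
  have "continuous_on P (\<lambda>t. (f t, g t))"
    using f g by (auto simp: RUC_iff[OF P] intro: continuous_intros)
  then have "continuous_on P (\<lambda>t. F (f t) (g t))"
    using continuous_on_compose2[OF continuous_at_imp_continuous_on[of UNIV "\<lambda>p. F (fst p) (snd p)"]]
      cont by fastforce
  moreover have "bounded ((\<lambda>t. F (f t) (g t)) ` P)"
  proof -
    have "bounded (f ` P)" "bounded (g ` P)"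
      using f g by (simp_all add: RUC_iff[OF P])
    then obtain A B where "\<And>t. t \<in> P \<Longrightarrow> norm (f t) \<le> A" "\<And>t. t \<in> P \<Longrightarrow> norm (g t) \<le> B"
      by (meson bounded_iff imageI)
    then have "norm (F (f t) (g t)) \<le> K * A + K * B" if "t \<in> P" for t
      using lip[of "f t" "g t" 0 0] F0 that K
      by (smt (verit, best) diff_zero mult_le_cancel_left_pos)
    then show ?thesis
      by (auto simp: bounded_iff)
  qed
  moreover have "\<exists>U. open U \<and> s \<in> U \<and> (\<forall>u\<in>U \<inter> P. \<forall>t\<in>P.
      norm (F (f (u * t)) (g (u * t)) - F (f (s * t)) (g (s * t))) \<le> e)"
    if s: "s \<in> P" "e > 0" for s e
  proof -
    have e: "e / (2 * K) > 0"
      using \<open>e > 0\<close> K by simp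
    from RUC_neighbourhood[OF P f s(1) e] obtain U where U: "open U" "s \<in> U"
        "\<And>u t. u \<in> U \<Longrightarrow> u \<in> P \<Longrightarrow> t \<in> P \<Longrightarrow> norm (f (u * t) - f (s * t)) \<le> e / (2 * K)"
      by blast
    from RUC_neighbourhood[OF P g s(1) e] obtain U' where U': "open U'" "s \<in> U'"
        "\<And>u t. u \<in> U' \<Longrightarrow> u \<in> P \<Longrightarrow> t \<in> P \<Longrightarrow> norm (g (u * t) - g (s * t)) \<le> e / (2 * K)"
      by blast
    have "norm (F (f (u * t)) (g (u * t)) - F (f (s * t)) (g (s * t))) \<le> e"
      if "u \<in> U \<inter> U' \<inter> P" "t \<in> P" for u t
    proof -
      have "K * norm (f (u * t) - f (s * t)) \<le> e / 2" "K * norm (g (u * t) - g (s * t)) \<le> e / 2"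
        using U(3)[of u t] U'(3)[of u t] that K by (simp_all add: pos_le_divide_eq mult.commute)
      then show ?thesis
        using lip[of "f (u * t)" "g (u * t)" "f (s * t)" "g (s * t)"] by linarith
    qed
    then show ?thesis
      using U(1,2) U'(1,2) by (intro exI[of _ "U \<inter> U'"]) auto
  qed
  ultimately show ?thesis
    using f g F0 by (auto simp: RUC_iff[OF P])
qed

lemma RUC_add:
  assumes "subsemigroup P" "f \<in> RUC P" "g \<in> RUC P"
  shows "(\<lambda>t. f t + g t) \<in> RUC P"
  by (rule RUC_pointwise[OF assms, where K = 1])
    (auto simp: norm_triangle_le add_diff_add norm_triangle_ineq)

lemma RUC_scale:
  assumes "subsemigroup P" "f \<in> RUC P"
  shows "(\<lambda>t. c * f t) \<in> RUC P"
proof (rule RUC_pointwise[OF assms assms(2), where K = "norm c + 1" and F = "\<lambda>a b. c * a"])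
  show "norm (c * a - c * a') \<le> (norm c + 1) * norm (a - a') + (norm c + 1) * norm (b - b')" 
    for a b a' b' :: complex
  proof -
    have "norm (c * a - c * a') = norm c * norm (a - a')"
      by (simp add: norm_mult flip: right_diff_distrib)
    also have "\<dots> \<le> (norm c + 1) * norm (a - a')"
      by (simp add: mult_right_mono)
    finally show ?thesis
      by (smt (verit) norm_ge_zero mult_nonneg_nonneg)
  qed
qed (auto simp: add_nonneg_pos)

lemma RUC_one:
  fixes P :: "'a::topological_semigroup_mult set"
  assumes P: "subsemigroup P"
  shows "restrict_zero P (\<lambda>_. 1) \<in> RUC P"
proof -
  have cl: "\<And>s t. s \<in> P \<Longrightarrow> t \<in> P \<Longrightarrow> s * t \<in> P"
    using P by (auto simp: subsemigroup_def)
  have "continuous_on P (restrict_zero P (\<lambda>_. 1))"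
    using continuous_on_const[of P "1::complex"]
    by (simp add: restrict_zero_def cong: continuous_on_cong)
  moreover have "\<exists>U. open U \<and> s \<in> U \<and> (\<forall>u\<in>U \<inter> P. \<forall>t\<in>P.
      norm (restrict_zero P (\<lambda>_. 1) (u * t) - restrict_zero P (\<lambda>_. 1) (s * t)) \<le> e)"
    if "s \<in> P" "e > 0" for s and e :: real
    using that cl by (intro exI[of _ UNIV]) (auto simp: restrict_zero_def)
  ultimately show ?thesis
    by (auto simp: RUC_iff[OF P] restrict_zero_def bounded_iff)
qed

definition RUC_real :: "'a::topological_semigroup_mult set \<Rightarrow> ('a \<Rightarrow> real) set" where
  "RUC_real P = {f. (\<lambda>t. complex_of_real (f t)) \<in> RUC P}"

lemma RUC_real_add:
  assumes "subsemigroup P" "f \<in> RUC_real P" "g \<in> RUC_real P"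
  shows "(\<lambda>t. f t + g t) \<in> RUC_real P"
  using RUC_add[OF assms(1)] assms(2,3) by (simp add: RUC_real_def)

lemma RUC_real_scale:
  assumes "subsemigroup P" "f \<in> RUC_real P"
  shows "(\<lambda>t. c * f t) \<in> RUC_real P"
  using RUC_scale[OF assms(1), of _ "complex_of_real c"] assms(2) by (simp add: RUC_real_def)

lemma RUC_real_min:
  assumes P: "subsemigroup P" and f: "f \<in> RUC_real P" and g: "g \<in> RUC_real P"
  shows "(\<lambda>t. min (f t) (g t)) \<in> RUC_real P"
proof -
  have *: "norm (complex_of_real (min (Re a) (Re b)) - complex_of_real (min (Re c) (Re d)))
      \<le> 1 * norm (a - c) + 1 * norm (b - d)" for a b c d
  proof -
    have "\<bar>min (Re a) (Re b) - min (Re c) (Re d)\<bar> \<le> \<bar>Re (a - c)\<bar> + \<bar>Re (b - d)\<bar>"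
      by auto
    then show ?thesis
      using abs_Re_le_cmod[of "a - c"] abs_Re_le_cmod[of "b - d"]
      unfolding of_real_diff[symmetric] norm_of_real by linarith
  qed
  show ?thesis
    using RUC_pointwise[OF P, of "\<lambda>t. of_real (f t)" "\<lambda>t. of_real (g t)",
        where F = "\<lambda>a b. complex_of_real (min (Re a) (Re b))", OF _ _ _ _ *] f g
    by (simp add: RUC_real_def)
qed

section \<open>From an invariant functional to an invariant mean\<close>

text \<open>
  A linear functional on a vector lattice of functions that is bounded on order intervals has a
  positive part, the join of the functional with \<open>0\<close> in the order dual.
\<close>

locale order_bounded_functional =
  fixes F :: "('a \<Rightarrow> real) set" and L :: "('a \<Rightarrow> real) \<Rightarrow> real"
  assumes add_mem: "\<And>f g. f \<in> F \<Longrightarrow> g \<in> F \<Longrightarrow> (\<lambda>t. f t + g t) \<in> F"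
    and scale_mem: "\<And>f c. f \<in> F \<Longrightarrow> (\<lambda>t. c * f t) \<in> F"
    and min_mem: "\<And>f g. f \<in> F \<Longrightarrow> g \<in> F \<Longrightarrow> (\<lambda>t. min (f t) (g t)) \<in> F"
    and L_add: "\<And>f g. f \<in> F \<Longrightarrow> g \<in> F \<Longrightarrow> L (\<lambda>t. f t + g t) = L f + L g"
    and L_scale: "\<And>f c. f \<in> F \<Longrightarrow> L (\<lambda>t. c * f t) = c * L f"
    and order_bounded:
      "\<And>f. f \<in> F \<Longrightarrow> \<exists>B. \<forall>g\<in>F. (\<forall>t. 0 \<le> g t \<and> g t \<le> f t) \<longrightarrow> L g \<le> B"
begin

definition sup_below :: "('a \<Rightarrow> real) \<Rightarrow> real" where
  "sup_below f = Sup (L ` {g \<in> F. \<forall>t. 0 \<le> g t \<and> g t \<le> f t})"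

text \<open>
  On nonnegative functions the positive part is \<open>sup_below\<close>. The splitting of a function into its
  positive and negative parts extends it linearly to the whole lattice.
\<close>

definition pos_part :: "('a \<Rightarrow> real) \<Rightarrow> real" where
  "pos_part f = sup_below (\<lambda>t. max (f t) 0) - sup_below (\<lambda>t. max (- f t) 0)"

lemma diff_mem: "f \<in> F \<Longrightarrow> g \<in> F \<Longrightarrow> (\<lambda>t. f t - g t) \<in> F"
  using add_mem[of f "\<lambda>t. (-1) * g t"] scale_mem[of g "-1"] by simp

lemma zero_mem: "f \<in> F \<Longrightarrow> (\<lambda>t. 0) \<in> F"
  using scale_mem[of f 0] by simp

lemma L_zero: "f \<in> F \<Longrightarrow> L (\<lambda>t. 0) = 0"
  using L_scale[of f 0] by simp

lemma max_zero_mem: "f \<in> F \<Longrightarrow> (\<lambda>t. max (f t) 0) \<in> F"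
proof -
  assume f: "f \<in> F"
  have "(\<lambda>t. (-1) * min ((-1) * f t) 0) \<in> F"
    by (intro scale_mem min_mem f zero_mem[OF f])
  moreover have "(\<lambda>t. (-1) * min ((-1) * f t) 0) = (\<lambda>t. max (f t) 0)"
    by auto
  ultimately show ?thesis
    by simp
qed

lemma uminus_mem: "f \<in> F \<Longrightarrow> (\<lambda>t. - f t) \<in> F"
  using scale_mem[of f "-1"] by simp

lemma le_sup_below:
  assumes "f \<in> F" "g \<in> F" "\<And>t. 0 \<le> g t" "\<And>t. g t \<le> f t"
  shows "L g \<le> sup_below f"
  unfolding sup_below_def
proof (rule cSup_upper)
  show "bdd_above (L ` {g \<in> F. \<forall>t. 0 \<le> g t \<and> g t \<le> f t})"
    using order_bounded[OF assms(1)] by (auto simp: bdd_above_def)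
qed (use assms in auto)

lemma sup_below_le:
  assumes "f \<in> F" "\<And>t. 0 \<le> f t"
    and "\<And>g. g \<in> F \<Longrightarrow> (\<And>t. 0 \<le> g t) \<Longrightarrow> (\<And>t. g t \<le> f t) \<Longrightarrow> L g \<le> B"
  shows "sup_below f \<le> B"
  unfolding sup_below_def
  by (rule cSup_least) (use assms in auto)

lemma sup_below_nonneg:
  assumes "f \<in> F" "\<And>t. 0 \<le> f t"
  shows "0 \<le> sup_below f"
  using le_sup_below[of f "\<lambda>t. 0"] zero_mem[OF assms(1)] L_zero[OF assms(1)] assms by simp

text \<open>
  The inequality \<open>\<le>\<close> is the Riesz decomposition property: \<open>0 \<le> h \<le> f + g\<close> splits as
  \<open>h = min h f + (h - min h f)\<close> with summands below \<open>f\<close> and below \<open>g\<close>.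
\<close>

lemma sup_below_add:
  assumes f: "f \<in> F" "\<And>t. 0 \<le> f t" and g: "g \<in> F" "\<And>t. 0 \<le> g t"
  shows "sup_below (\<lambda>t. f t + g t) = sup_below f + sup_below g"
proof (rule antisym)
  show "sup_below (\<lambda>t. f t + g t) \<le> sup_below f + sup_below g"
  proof (rule sup_below_le)
    fix h assume h: "h \<in> F" "\<And>t. 0 \<le> h t" "\<And>t. h t \<le> f t + g t"
    have h1: "(\<lambda>t. min (h t) (f t)) \<in> F" and h2: "(\<lambda>t. h t - min (h t) (f t)) \<in> F"
      by (intro min_mem diff_mem h f)+
    have "L h = L (\<lambda>t. min (h t) (f t)) + L (\<lambda>t. h t - min (h t) (f t))"
      using L_add[OF h1 h2] by simp
    also have "\<dots> \<le> sup_below f + sup_below g"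
    proof (intro add_mono le_sup_below h1 h2 f g)
      fix t
      show "0 \<le> min (h t) (f t)" "min (h t) (f t) \<le> f t" "0 \<le> h t - min (h t) (f t)"
        using h f by auto
      show "h t - min (h t) (f t) \<le> g t"
        using h(3)[of t] g(2)[of t] by auto
    qed
    finally show "L h \<le> sup_below f + sup_below g" .
  qed (use f g add_mem in auto)
  have "sup_below f \<le> sup_below (\<lambda>t. f t + g t) - sup_below g"
  proof (rule sup_below_le[OF f])
    fix h assume h: "h \<in> F" "\<And>t. 0 \<le> h t" "\<And>t. h t \<le> f t"
    have "sup_below g \<le> sup_below (\<lambda>t. f t + g t) - L h"
    proof (rule sup_below_le[OF g])
      fix k assume k: "k \<in> F" "\<And>t. 0 \<le> k t" "\<And>t. k t \<le> g t"
      have "L h + L k = L (\<lambda>t. h t + k t)"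
        using L_add h k by simp
      also have "\<dots> \<le> sup_below (\<lambda>t. f t + g t)"
        by (intro le_sup_below add_mem f g h k add_nonneg_nonneg add_mono)
      finally show "L k \<le> sup_below (\<lambda>t. f t + g t) - L h"
        by simp
    qed
    then show "L h \<le> sup_below (\<lambda>t. f t + g t) - sup_below g"
      by simp
  qed
  then show "sup_below f + sup_below g \<le> sup_below (\<lambda>t. f t + g t)"
    by simp
qed

lemma sup_below_scale:
  assumes f: "f \<in> F" "\<And>t. 0 \<le> f t" and c: "0 < c"
  shows "sup_below (\<lambda>t. c * f t) = c * sup_below f"
proof -
  have le: "sup_below (\<lambda>t. c * f t) \<le> c * sup_below f"
    if f: "f \<in> F" "\<And>t. 0 \<le> f t" and c: "0 < c" for f c
  proof (rule sup_below_le)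
    fix g assume g: "g \<in> F" "\<And>t. 0 \<le> g t" "\<And>t. g t \<le> c * f t"
    have "L (\<lambda>t. (1 / c) * g t) \<le> sup_below f"
      using g c by (intro le_sup_below f scale_mem) (simp_all add: pos_divide_le_eq mult.commute)
    then show "L g \<le> c * sup_below f"
      using c L_scale[OF g(1), of "1 / c"] by (simp add: pos_divide_le_eq mult.commute)
  qed (use f c scale_mem in auto)
  have "sup_below (\<lambda>t. (1 / c) * (c * f t)) \<le> (1 / c) * sup_below (\<lambda>t. c * f t)"
    using le[of "\<lambda>t. c * f t" "1 / c"] f c scale_mem by simp
  then have "c * sup_below f \<le> sup_below (\<lambda>t. c * f t)"
    using c by (simp add: field_simps)
  with le[OF f c] show ?thesis
    by simp
qed

text \<open>
  The value does not depend on how a function is written as a difference of nonnegative ones. This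
  makes \<open>pos_part\<close> linear.
\<close>

lemma pos_part_diff:
  assumes "a \<in> F" "\<And>t. 0 \<le> a t" "b \<in> F" "\<And>t. 0 \<le> b t"
  shows "pos_part (\<lambda>t. a t - b t) = sup_below a - sup_below b"
proof -
  have ab: "(\<lambda>t. a t - b t) \<in> F"
    using diff_mem assms by simp
  have p: "(\<lambda>t. max (a t - b t) 0) \<in> F" "(\<lambda>t. max (- (a t - b t)) 0) \<in> F"
    using max_zero_mem[OF ab] max_zero_mem[OF uminus_mem[OF ab]] by simp_all
  have "sup_below (\<lambda>t. max (a t - b t) 0) + sup_below b = sup_below (\<lambda>t. max (a t - b t) 0 + b t)"
    using sup_below_add[OF p(1) _ assms(3,4)] by simp
  also have "\<dots> = sup_below (\<lambda>t. a t + max (- (a t - b t)) 0)"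
    by (rule arg_cong[where f = sup_below]) auto
  also have "\<dots> = sup_below a + sup_below (\<lambda>t. max (- (a t - b t)) 0)"
    using sup_below_add[OF assms(1,2) p(2)] by simp
  finally show ?thesis
    by (simp add: pos_part_def)
qed

lemma pos_part_eq_sup_below:
  assumes "f \<in> F" "\<And>t. 0 \<le> f t"
  shows "pos_part f = sup_below f"
proof -
  have "sup_below (\<lambda>t. 0) = 0"
    using sup_below_add[of "\<lambda>t. 0" "\<lambda>t. 0"] zero_mem[OF assms(1)] by simp
  then show ?thesis
    using pos_part_diff[of f "\<lambda>t. 0"] assms zero_mem[OF assms(1)] by simp
qed

lemma pos_part_add:
  assumes f: "f \<in> F" and g: "g \<in> F"
  shows "pos_part (\<lambda>t. f t + g t) = pos_part f + pos_part g"
proof -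
  note p = max_zero_mem[OF f] max_zero_mem[OF uminus_mem[OF f]]
    max_zero_mem[OF g] max_zero_mem[OF uminus_mem[OF g]]
  have "(\<lambda>t. f t + g t) =
      (\<lambda>t. (max (f t) 0 + max (g t) 0) - (max (- f t) 0 + max (- g t) 0))"
    by auto
  then have "pos_part (\<lambda>t. f t + g t) =
      sup_below (\<lambda>t. max (f t) 0 + max (g t) 0) - sup_below (\<lambda>t. max (- f t) 0 + max (- g t) 0)"
    by (simp only:) (intro pos_part_diff add_mem p, auto)
  then show ?thesis
    by (simp add: pos_part_def sup_below_add p)
qed

lemma pos_part_scale:
  assumes f: "f \<in> F"
  shows "pos_part (\<lambda>t. c * f t) = c * pos_part f"
proof -
  note p = max_zero_mem[OF f] max_zero_mem[OF uminus_mem[OF f]]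
  have pos: "pos_part (\<lambda>t. c * f t) = c * pos_part f" if c: "c > 0" for c
  proof -
    have "(\<lambda>t. c * f t) = (\<lambda>t. c * max (f t) 0 - c * max (- f t) 0)"
      by (auto simp: max_def)
    then have "pos_part (\<lambda>t. c * f t) = sup_below (\<lambda>t. c * max (f t) 0) - sup_below (\<lambda>t. c * max (- f t) 0)"
      using c by (simp only:) (intro pos_part_diff scale_mem p, auto)
    then show ?thesis
      using c by (simp add: pos_part_def sup_below_scale p right_diff_distrib)
  qed
  have zero: "pos_part (\<lambda>t. 0) = 0"
    using pos_part_add[OF zero_mem[OF f] zero_mem[OF f]] by simp
  consider "c > 0" | "c = 0" | "c < 0"
    by linarith
  then show ?thesis
  proof cases
    case 3
    have "pos_part (\<lambda>t. c * f t) + pos_part (\<lambda>t. (- c) * f t) = 0"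
      using pos_part_add[OF scale_mem[OF f, of c] scale_mem[OF f, of "- c"]] zero by simp
    then show ?thesis
      using pos[of "- c"] 3 by simp
  qed (use pos zero in auto)
qed

text \<open>
  A positive operator \<open>T\<close> that preserves \<open>L\<close> can only increase \<open>sup_below\<close>, as it maps functions below
  \<open>g\<close> to functions below \<open>T g\<close>. If \<open>T\<close> fixes \<open>e\<close>, then the increases for \<open>f\<close> and \<open>e - f\<close> add up to zero, so
  both vanish.
\<close>

lemma sup_below_invariant:
  assumes T_mem: "\<And>g. g \<in> F \<Longrightarrow> T g \<in> F"
    and T_nonneg: "\<And>g. g \<in> F \<Longrightarrow> (\<And>t. 0 \<le> g t) \<Longrightarrow> (\<And>t. 0 \<le> T g t)"
    and T_diff: "\<And>g h. g \<in> F \<Longrightarrow> h \<in> F \<Longrightarrow> T (\<lambda>t. g t - h t) = (\<lambda>t. T g t - T h t)"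
    and L_T: "\<And>g. g \<in> F \<Longrightarrow> L (T g) = L g"
    and e: "e \<in> F" "T e = e"
    and f: "f \<in> F" "\<And>t. 0 \<le> f t" "\<And>t. f t \<le> e t"
  shows "sup_below (T f) = sup_below f"
proof -
  have mono: "sup_below g \<le> sup_below (T g)" if g: "g \<in> F" "\<And>t. 0 \<le> g t" for g
  proof (rule sup_below_le[OF g])
    fix h assume h: "h \<in> F" "\<And>t. 0 \<le> h t" "\<And>t. h t \<le> g t"
    have "0 \<le> T (\<lambda>t. g t - h t) t" for t
      using h g by (intro T_nonneg diff_mem) auto
    then have "L (T h) \<le> sup_below (T g)"
      using h g T_diff by (intro le_sup_below T_mem T_nonneg) auto
    then show "L h \<le> sup_below (T g)"
      using L_T h(1) by simp
  qed
  have ef: "(\<lambda>t. e t - f t) \<in> F" "\<And>t. 0 \<le> e t - f t"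
    using e f diff_mem by auto
  have "sup_below f + sup_below (\<lambda>t. e t - f t) = sup_below e"
    using sup_below_add[OF f(1,2) ef] by simp
  also have "\<dots> = sup_below (\<lambda>t. T f t + T (\<lambda>t. e t - f t) t)"
    using T_diff[OF e(1) f(1)] e(2) by simp
  also have "\<dots> = sup_below (T f) + sup_below (T (\<lambda>t. e t - f t))"
    by (rule sup_below_add) (use T_mem T_nonneg f ef in auto)
  finally show ?thesis
    using mono[OF f(1,2)] mono[OF ef] by simp
qed

text \<open>
  The positive and negative parts of \<open>f\<close> lie below a multiple of \<open>e\<close>, which \<open>T\<close> also fixes, so
  \<open>sup_below_invariant\<close> applies to each of them.
\<close>

lemma pos_part_invariant:
  assumes T_mem: "\<And>g. g \<in> F \<Longrightarrow> T g \<in> F"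
    and T_nonneg: "\<And>g. g \<in> F \<Longrightarrow> (\<And>t. 0 \<le> g t) \<Longrightarrow> (\<And>t. 0 \<le> T g t)"
    and T_diff: "\<And>g h. g \<in> F \<Longrightarrow> h \<in> F \<Longrightarrow> T (\<lambda>t. g t - h t) = (\<lambda>t. T g t - T h t)"
    and L_T: "\<And>g. g \<in> F \<Longrightarrow> L (T g) = L g"
    and T_scale: "\<And>g c. g \<in> F \<Longrightarrow> T (\<lambda>t. c * g t) = (\<lambda>t. c * T g t)"
    and e: "e \<in> F" "T e = e" "\<And>t. 0 \<le> e t"
    and f: "f \<in> F" "\<And>t. \<bar>f t\<bar> \<le> K * e t"
  shows "pos_part (T f) = pos_part f"
proof -
  note p = max_zero_mem[OF f(1)] max_zero_mem[OF uminus_mem[OF f(1)]]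
  have Ke: "(\<lambda>t. K * e t) \<in> F" "T (\<lambda>t. K * e t) = (\<lambda>t. K * e t)"
    using scale_mem T_scale e by auto
  have split: "T f = (\<lambda>t. T (\<lambda>t. max (f t) 0) t - T (\<lambda>t. max (- f t) 0) t)"
  proof -
    have "f = (\<lambda>t. max (f t) 0 - max (- f t) 0)"
      by auto
    then show ?thesis
      using T_diff[OF p] by simp
  qed
  have bound: "max (f t) 0 \<le> K * e t" "max (- f t) 0 \<le> K * e t" for t
    using f(2)[of t] by auto
  have *: "sup_below (T (\<lambda>t. max (f t) 0)) = sup_below (\<lambda>t. max (f t) 0)"
    "sup_below (T (\<lambda>t. max (- f t) 0)) = sup_below (\<lambda>t. max (- f t) 0)"
    by (rule sup_below_invariant[where T = T, OF T_mem T_nonneg T_diff L_T Ke];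
        use p bound in simp)+
  show ?thesis
    unfolding split using p by (subst pos_part_diff) (auto simp: T_mem T_nonneg * pos_part_def)
qed

end

definition real_translate :: "'a::times set \<Rightarrow> ('a \<Rightarrow> real) \<Rightarrow> 'a \<Rightarrow> 'a \<Rightarrow> real" where
  "real_translate P f s = (\<lambda>t. if t \<in> P then f (s * t) else 0)"

text \<open>
  The function \<open>indicator P\<close> is the constant \<open>1\<close> on \<open>P\<close>, extended by \<open>0\<close> like all members of \<open>RUC_real P\<close>.
\<close>

definition invariant_mean ::
    "'a::topological_semigroup_mult set \<Rightarrow> (('a \<Rightarrow> real) \<Rightarrow> real) \<Rightarrow> bool" where
  "invariant_mean P M \<longleftrightarrow>
     (\<forall>f\<in>RUC_real P. \<forall>g\<in>RUC_real P. M (\<lambda>t. f t + g t) = M f + M g) \<and>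
     (\<forall>c. \<forall>f\<in>RUC_real P. M (\<lambda>t. c * f t) = c * M f) \<and>
     (\<forall>f\<in>RUC_real P. (\<forall>t. 0 \<le> f t) \<longrightarrow> 0 \<le> M f) \<and>
     M (indicator P) = 1 \<and>
     (\<forall>f\<in>RUC_real P. \<forall>s\<in>P. M (real_translate P f s) = M f)"

lemma of_real_real_translate:
  "(\<lambda>t. complex_of_real (real_translate P f s t)) = translate P (\<lambda>t. complex_of_real (f t)) s"
  by (auto simp: real_translate_def translate_def restrict_zero_def)

lemma of_real_indicator_eq:
  "(\<lambda>t. complex_of_real (indicator P t)) = restrict_zero P (\<lambda>_. 1)"
  by (auto simp: restrict_zero_def)

text \<open>
  The real part of \<open>m\<close> on real functions is bounded on order intervals because \<open>m\<close> is bounded in the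
  sup norm. Its positive part takes a value of at least \<open>m(1) = 1\<close> at the constant function, so it can be
  normalised.
\<close>

theorem invariant_functional_imp_mean:
  assumes P: "subsemigroup P" and m: "RUC_functional P m" and one: "m (restrict_zero P (\<lambda>_. 1)) = 1"
    and inv: "translation_invariant P m"
  shows "\<exists>M. invariant_mean P M"
proof -
  define L where "L f = Re (m (\<lambda>t. complex_of_real (f t)))" for f
  obtain K where K: "\<And>f. f \<in> RUC P \<Longrightarrow> norm (m f) \<le> K * sup_norm P f"
    using m unfolding RUC_functional_def by blast
  have ne: "P \<noteq> {}" and cl: "\<And>s t. s \<in> P \<Longrightarrow> t \<in> P \<Longrightarrow> s * t \<in> P"
    using P by (auto simp: subsemigroup_def)
  have bdd: "bounded ((\<lambda>t. complex_of_real (f t)) ` P)" if "f \<in> RUC_real P" for f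
    using that by (simp add: RUC_real_def RUC_iff[OF P])
  have vanish: "f t = 0" if "f \<in> RUC_real P" "t \<notin> P" for f t
    using that by (auto simp: RUC_real_def RUC_iff[OF P])
  interpret order_bounded_functional "RUC_real P" L
  proof
    fix f g :: "'a \<Rightarrow> real"
    assume f: "f \<in> RUC_real P" and g: "g \<in> RUC_real P"
    show "L (\<lambda>t. f t + g t) = L f + L g"
      using m f g by (simp add: L_def RUC_functional_def RUC_real_def)
  next
    fix f :: "'a \<Rightarrow> real" and c :: real
    assume f: "f \<in> RUC_real P"
    show "L (\<lambda>t. c * f t) = c * L f"
      using m f by (simp add: L_def RUC_functional_def RUC_real_def)
  next
    fix f assume f: "f \<in> RUC_real P"
    let ?S = "sup_norm P (\<lambda>t. complex_of_real (f t))"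
    have "L g \<le> \<bar>K\<bar> * ?S" if g: "g \<in> RUC_real P" "\<forall>t. 0 \<le> g t \<and> g t \<le> f t" for g
    proof -
      have "norm (complex_of_real (g t)) \<le> ?S" if "t \<in> P" for t
        using norm_le_sup_norm[OF that bdd[OF f]] g(2)
        by (smt (verit, best) norm_of_real)
      then have "sup_norm P (\<lambda>t. complex_of_real (g t)) \<le> ?S"
        using sup_norm_le_iff[OF ne bdd[OF g(1)]] by blast
      moreover have "0 \<le> sup_norm P (\<lambda>t. complex_of_real (g t))"
        by (rule sup_norm_nonneg[OF ne bdd[OF g(1)]])
      moreover have "L g \<le> K * sup_norm P (\<lambda>t. complex_of_real (g t))"
        using K[of "\<lambda>t. complex_of_real (g t)"] g(1) complex_Re_le_cmod order_trans
        unfolding L_def RUC_real_def by blast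
      ultimately show ?thesis
        by (smt (verit, best) mult_mono mult_right_mono)
    qed
    then show "\<exists>B. \<forall>g\<in>RUC_real P. (\<forall>t. 0 \<le> g t \<and> g t \<le> f t) \<longrightarrow> L g \<le> B"
      by blast
  qed (use RUC_real_add[OF P] RUC_real_scale[OF P] RUC_real_min[OF P] in auto)
  let ?e = "indicator P :: 'a \<Rightarrow> real"
  have e: "?e \<in> RUC_real P" "L ?e = 1"
    using RUC_one[OF P] one by (simp_all add: RUC_real_def L_def of_real_indicator_eq)
  have pos: "1 \<le> sup_below ?e"
    using le_sup_below[of ?e ?e] e by simp
  have T: "pos_part (real_translate P f s) = pos_part f" if s: "s \<in> P" and f: "f \<in> RUC_real P" for f s
  proof -
    obtain C where "\<And>t. t \<in> P \<Longrightarrow> norm (complex_of_real (f t)) \<le> C"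
      using bdd[OF f] unfolding bounded_iff by blast
    then have "\<bar>f t\<bar> \<le> C * ?e t" for t
      using vanish[OF f, of t] by (cases "t \<in> P") auto
    moreover have "real_translate P ?e s = ?e"
      using cl s by (auto simp: real_translate_def indicator_def)
    moreover have "L (real_translate P g s) = L g" if "g \<in> RUC_real P" for g
      using inv s that by (simp add: L_def of_real_real_translate translation_invariant_def RUC_real_def)
    moreover have "real_translate P g s \<in> RUC_real P" if "g \<in> RUC_real P" for g
      using RUC_translate[OF P _ s] that by (simp add: RUC_real_def of_real_real_translate)
    ultimately show ?thesis
      using e(1) f by (intro pos_part_invariant[where e = ?e and K = C and T = "\<lambda>f. real_translate P f s"])
        (auto simp: real_translate_def)
  qed
  have "invariant_mean P (\<lambda>f. pos_part f / sup_below ?e)"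
    unfolding invariant_mean_def
    using pos e(1) T pos_part_add pos_part_scale sup_below_nonneg pos_part_eq_sup_below
    by (auto simp: add_divide_distrib)
  then show ?thesis
    by blast
qed

section \<open>Hahn-Banach separation in locally convex spaces\<close>

lemma cring_real_ring: "cring (ring_of_type_algebra :: real ring)"
  by (rule cring_from_type_algebra)

lemma ring_of_type_algebra_simps:
  "carrier ring_of_type_algebra = UNIV"
  "a \<oplus>\<^bsub>ring_of_type_algebra\<^esub> b = a + b"
  "a \<otimes>\<^bsub>ring_of_type_algebra\<^esub> b = a * b"
  "\<one>\<^bsub>ring_of_type_algebra\<^esub> = 1"
  "\<zero>\<^bsub>ring_of_type_algebra\<^esub> = 0"
  by (simp_all add: ring_of_type_algebra_def)

locale real_module =
  Module.module "ring_of_type_algebra :: real ring" V for V :: "(real, 'v) module" (structure)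
begin

lemma scale_closed: "x \<in> carrier V \<Longrightarrow> a \<odot> x \<in> carrier V"
  using smult_closed[of a x] by (simp add: ring_of_type_algebra_simps)

lemma scale_add_left: "x \<in> carrier V \<Longrightarrow> (a + b) \<odot> x = a \<odot> x \<oplus>\<^bsub>V\<^esub> b \<odot> x"
  using smult_l_distr[of a b x] by (simp add: ring_of_type_algebra_simps)

lemma scale_add_right:
  "x \<in> carrier V \<Longrightarrow> y \<in> carrier V \<Longrightarrow> a \<odot> (x \<oplus>\<^bsub>V\<^esub> y) = a \<odot> x \<oplus>\<^bsub>V\<^esub> a \<odot> y"
  using smult_r_distr[of a x y] by (simp add: ring_of_type_algebra_simps)

lemma scale_scale: "x \<in> carrier V \<Longrightarrow> a \<odot> (b \<odot> x) = (a * b) \<odot> x"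
  using smult_assoc1[of a b x] by (simp add: ring_of_type_algebra_simps)

lemma scale_one: "x \<in> carrier V \<Longrightarrow> 1 \<odot> x = x"
  using smult_one[of x] by (simp add: ring_of_type_algebra_simps)

lemma scale_zero: "x \<in> carrier V \<Longrightarrow> 0 \<odot> x = \<zero>\<^bsub>V\<^esub>"
  using smult_l_null[of x] by (simp add: ring_of_type_algebra_simps)

lemma scale_zero_right: "a \<odot> \<zero>\<^bsub>V\<^esub> = \<zero>\<^bsub>V\<^esub>"
  using smult_r_null[of a] by (simp add: ring_of_type_algebra_simps)

lemma add_uminus: "x \<in> carrier V \<Longrightarrow> x \<oplus>\<^bsub>V\<^esub> (-1) \<odot> x = \<zero>\<^bsub>V\<^esub>"
  using scale_add_left[of x 1 "-1"] by (simp add: scale_one scale_zero)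

lemma uminus_add: "x \<in> carrier V \<Longrightarrow> (-1) \<odot> x \<oplus>\<^bsub>V\<^esub> x = \<zero>\<^bsub>V\<^esub>"
  using scale_add_left[of x "-1" 1] by (simp add: scale_one scale_zero)

lemmas vector_simps = scale_closed scale_add_left scale_add_right scale_scale scale_one scale_zero
  scale_zero_right add_uminus uminus_add

definition sublinear :: "('v \<Rightarrow> real) \<Rightarrow> bool" where
  "sublinear q \<longleftrightarrow>
     (\<forall>x\<in>carrier V. \<forall>y\<in>carrier V. q (x \<oplus>\<^bsub>V\<^esub> y) \<le> q x + q y) \<and>
     (\<forall>c>0. \<forall>x\<in>carrier V. q (c \<odot> x) \<le> c * q x)"

definition linear_on_carrier :: "('v \<Rightarrow> real) \<Rightarrow> bool" where
  "linear_on_carrier q \<longleftrightarrow>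
     (\<forall>x\<in>carrier V. \<forall>y\<in>carrier V. q (x \<oplus>\<^bsub>V\<^esub> y) = q x + q y) \<and>
     (\<forall>c. \<forall>x\<in>carrier V. q (c \<odot> x) = c * q x)"

lemma sublinear_add:
  "sublinear q \<Longrightarrow> x \<in> carrier V \<Longrightarrow> y \<in> carrier V \<Longrightarrow> q (x \<oplus>\<^bsub>V\<^esub> y) \<le> q x + q y"
  by (simp add: sublinear_def)

lemma sublinear_zero:
  assumes "sublinear q"
  shows "q \<zero>\<^bsub>V\<^esub> = 0"
proof -
  have "q (c \<odot> \<zero>\<^bsub>V\<^esub>) \<le> c * q \<zero>\<^bsub>V\<^esub>" if "c > 0" for c
    using assms that by (simp add: sublinear_def)
  from this[of 2] this[of "1/2"] show ?thesis
    by (simp add: scale_zero_right)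
qed

lemma sublinear_scale:
  assumes q: "sublinear q" and x: "x \<in> carrier V" and c: "0 \<le> c"
  shows "q (c \<odot> x) = c * q x"
proof (cases "c = 0")
  case True
  then show ?thesis
    using sublinear_zero[OF q] x by (simp add: scale_zero)
next
  case False
  have le: "q (a \<odot> y) \<le> a * q y" if "a > 0" "y \<in> carrier V" for a y
    using q that by (simp add: sublinear_def)
  have "q ((1 / c) \<odot> (c \<odot> x)) \<le> (1 / c) * q (c \<odot> x)"
    using False c x by (intro le scale_closed) auto
  then have "c * q x \<le> q (c \<odot> x)"
    using False c x by (simp add: vector_simps field_simps)
  then show ?thesis
    using le[of c x] False c x by simp
qed

lemma sublinear_uminus:
  assumes "sublinear q" "x \<in> carrier V"
  shows "- q ((-1) \<odot> x) \<le> q x"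
  using sublinear_add[OF assms scale_closed[OF assms(2), of "-1"]] sublinear_zero[OF assms(1)] assms(2)
  by (simp add: add_uminus)

text \<open>
  Hahn-Banach is proved through minimal sublinear functionals instead of extensions from subspaces.
  For a sublinear \<open>q\<close>, \<open>shave q x\<close> is a sublinear functional below \<open>q\<close> whose value at \<open>- x\<close> is at most
  \<open>- q x\<close>. A minimal \<open>q\<close> cannot be lowered this way, so it is odd and hence linear.
\<close>

definition shave :: "('v \<Rightarrow> real) \<Rightarrow> 'v \<Rightarrow> 'v \<Rightarrow> real" where
  "shave q x v = (INF t\<in>{0..}. q (v \<oplus>\<^bsub>V\<^esub> t \<odot> x) - t * q x)"

lemma shave_le:
  assumes q: "sublinear q" and x: "x \<in> carrier V" and v: "v \<in> carrier V" and t: "0 \<le> t"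
  shows "shave q x v \<le> q (v \<oplus>\<^bsub>V\<^esub> t \<odot> x) - t * q x"
  unfolding shave_def
proof (rule cINF_lower)
  have "- q ((-1) \<odot> v) \<le> q (v \<oplus>\<^bsub>V\<^esub> t \<odot> x) - t * q x" if "0 \<le> t" for t
  proof -
    have "t * q x = q (t \<odot> x)"
      using sublinear_scale[OF q x that] by simp
    also have "t \<odot> x = (v \<oplus>\<^bsub>V\<^esub> t \<odot> x) \<oplus>\<^bsub>V\<^esub> (-1) \<odot> v"
    proof -
      have "(v \<oplus>\<^bsub>V\<^esub> t \<odot> x) \<oplus>\<^bsub>V\<^esub> (-1) \<odot> v = t \<odot> x \<oplus>\<^bsub>V\<^esub> (v \<oplus>\<^bsub>V\<^esub> (-1) \<odot> v)"
        using v x by (simp add: M.a_ac scale_closed)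
      then show ?thesis
        using v x by (simp add: vector_simps)
    qed
    also have "q \<dots> \<le> q (v \<oplus>\<^bsub>V\<^esub> t \<odot> x) + q ((-1) \<odot> v)"
      using q x v by (intro sublinear_add) (auto simp: scale_closed)
    finally show ?thesis
      by simp
  qed
  then show "bdd_below ((\<lambda>t. q (v \<oplus>\<^bsub>V\<^esub> t \<odot> x) - t * q x) ` {0..})"
    by (intro bdd_belowI2) auto
qed (use t in simp)

lemma shave_le_self:
  assumes "sublinear q" "x \<in> carrier V" "v \<in> carrier V"
  shows "shave q x v \<le> q v"
  using shave_le[OF assms, of 0] assms by (simp add: scale_zero)

lemma shave_uminus_le:
  assumes "sublinear q" "x \<in> carrier V"
  shows "shave q x ((-1) \<odot> x) \<le> - q x"
  using shave_le[OF assms scale_closed[OF assms(2)], of 1 "-1"] assms sublinear_zero[OF assms(1)]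
  by (simp add: scale_one uminus_add)

lemma le_shave:
  assumes "\<And>t. 0 \<le> t \<Longrightarrow> B \<le> q (v \<oplus>\<^bsub>V\<^esub> t \<odot> x) - t * q x"
  shows "B \<le> shave q x v"
  unfolding shave_def by (rule cINF_greatest) (use assms in auto)

lemma sublinear_shave:
  assumes q: "sublinear q" and x: "x \<in> carrier V"
  shows "sublinear (shave q x)"
  unfolding sublinear_def
proof (intro conjI ballI allI impI)
  fix v w assume v: "v \<in> carrier V" and w: "w \<in> carrier V"
  have *: "shave q x (v \<oplus>\<^bsub>V\<^esub> w) \<le>
      (q (v \<oplus>\<^bsub>V\<^esub> s \<odot> x) - s * q x) + (q (w \<oplus>\<^bsub>V\<^esub> t \<odot> x) - t * q x)"
    if "0 \<le> s" "0 \<le> t" for s t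
  proof -
    have "shave q x (v \<oplus>\<^bsub>V\<^esub> w) \<le> q ((v \<oplus>\<^bsub>V\<^esub> w) \<oplus>\<^bsub>V\<^esub> (s + t) \<odot> x) - (s + t) * q x"
      using that v w by (intro shave_le q x) auto
    also have "(v \<oplus>\<^bsub>V\<^esub> w) \<oplus>\<^bsub>V\<^esub> (s + t) \<odot> x = (v \<oplus>\<^bsub>V\<^esub> s \<odot> x) \<oplus>\<^bsub>V\<^esub> (w \<oplus>\<^bsub>V\<^esub> t \<odot> x)"
      using v w x by (simp add: scale_add_left scale_closed M.a_ac)
    also have "q \<dots> \<le> q (v \<oplus>\<^bsub>V\<^esub> s \<odot> x) + q (w \<oplus>\<^bsub>V\<^esub> t \<odot> x)"
      using v w x by (intro sublinear_add q) (auto simp: scale_closed)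
    finally show ?thesis
      by (simp add: algebra_simps)
  qed
  have "shave q x (v \<oplus>\<^bsub>V\<^esub> w) - shave q x w \<le> q (v \<oplus>\<^bsub>V\<^esub> s \<odot> x) - s * q x" if "0 \<le> s" for s
  proof -
    have "shave q x (v \<oplus>\<^bsub>V\<^esub> w) - (q (v \<oplus>\<^bsub>V\<^esub> s \<odot> x) - s * q x) \<le> shave q x w"
      by (rule le_shave) (use *[OF that] in \<open>simp add: algebra_simps\<close>)
    then show ?thesis
      by simp
  qed
  then have "shave q x (v \<oplus>\<^bsub>V\<^esub> w) - shave q x w \<le> shave q x v"
    by (rule le_shave)
  then show "shave q x (v \<oplus>\<^bsub>V\<^esub> w) \<le> shave q x v + shave q x w"
    by simp
next
  fix c :: real and v assume c: "0 < c" and v: "v \<in> carrier V"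
  have "(1 / c) * shave q x (c \<odot> v) \<le> q (v \<oplus>\<^bsub>V\<^esub> t \<odot> x) - t * q x" if "0 \<le> t" for t
  proof -
    have "shave q x (c \<odot> v) \<le> q (c \<odot> v \<oplus>\<^bsub>V\<^esub> (c * t) \<odot> x) - (c * t) * q x"
      using c v that by (intro shave_le q x) (auto simp: scale_closed)
    also have "c \<odot> v \<oplus>\<^bsub>V\<^esub> (c * t) \<odot> x = c \<odot> (v \<oplus>\<^bsub>V\<^esub> t \<odot> x)"
      using v x by (simp add: vector_simps)
    also have "q \<dots> = c * q (v \<oplus>\<^bsub>V\<^esub> t \<odot> x)"
      using v x c by (intro sublinear_scale q) (auto simp: scale_closed)
    finally have "shave q x (c \<odot> v) \<le> c * (q (v \<oplus>\<^bsub>V\<^esub> t \<odot> x) - t * q x)"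
      by (simp add: algebra_simps)
    then show ?thesis
      using c by (simp add: pos_divide_le_eq mult.commute)
  qed
  then have "(1 / c) * shave q x (c \<odot> v) \<le> shave q x v"
    by (rule le_shave)
  then show "shave q x (c \<odot> v) \<le> c * shave q x v"
    using c by (simp add: pos_divide_le_eq mult.commute)
qed

text \<open>
  Zorn's lemma, with pointwise infima of chains as bounds; they are finite because \<open>q x \<ge> - p (- x)\<close>
  for all sublinear \<open>q \<le> p\<close>. Functions are normalised to \<open>0\<close> off the carrier so that comparing
  them on the carrier is comparing them everywhere.
\<close>

lemma exists_minimal_sublinear:
  assumes p: "sublinear p"
  shows "\<exists>q. sublinear q \<and> (\<forall>x\<in>carrier V. q x \<le> p x) \<and>
    (\<forall>r. sublinear r \<longrightarrow> (\<forall>x\<in>carrier V. r x \<le> q x) \<longrightarrow> (\<forall>x\<in>carrier V. r x = q x))"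
proof -
  define A where
    "A = {q. sublinear q \<and> (\<forall>x\<in>carrier V. q x \<le> p x) \<and> (\<forall>x. x \<notin> carrier V \<longrightarrow> q x = 0)}"
  define P where "P a b \<longleftrightarrow> (\<forall>x. b x \<le> a x)" for a b :: "'v \<Rightarrow> real"
  have cut: "sublinear (\<lambda>x. if x \<in> carrier V then q x else 0)" if "sublinear q" for q
    using that by (simp add: sublinear_def scale_closed)
  have "\<exists>m\<in>A. \<forall>a\<in>A. P m a \<longrightarrow> a = m"
  proof (rule predicate_Zorn)
    show "partial_order_on A (relation_of P A)"
      by (rule partial_order_on_relation_ofI)
        (auto simp: P_def fun_eq_iff intro: order_trans antisym)
  next
    fix C assume C: "C \<in> Chains (relation_of P A)"
    then have CA: "q \<in> A" if "q \<in> C" for q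
      using that by (auto simp: Chains_def relation_of_def)
    have total: "P a b \<or> P b a" if "a \<in> C" "b \<in> C" for a b
      using C that by (auto simp: Chains_def relation_of_def)
    show "\<exists>u\<in>A. \<forall>a\<in>C. P a u"
    proof (cases "C = {}")
      case True
      have "(\<lambda>x. if x \<in> carrier V then p x else 0) \<in> A"
        using cut[OF p] by (simp add: A_def)
      then show ?thesis
        using True by blast
    next
      case False
      define u where "u x = (if x \<in> carrier V then INF q\<in>C. q x else 0)" for x
      have u_le: "u x \<le> q x" if "q \<in> C" "x \<in> carrier V" for q x
      proof -
        have "- p ((-1) \<odot> x) \<le> r x" if "r \<in> C" for r
          using sublinear_uminus[of r x] CA[OF that] \<open>x \<in> carrier V\<close> scale_closed[of x "-1"]
          by (fastforce simp: A_def)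
        then have "bdd_below ((\<lambda>q. q x) ` C)"
          by (rule bdd_belowI2)
        then have "(INF q\<in>C. q x) \<le> q x"
          using \<open>q \<in> C\<close> by (rule cINF_lower)
        then show ?thesis
          using that by (simp add: u_def)
      qed
      have le_u: "B \<le> u x" if "x \<in> carrier V" "\<And>q. q \<in> C \<Longrightarrow> B \<le> q x" for B x
        unfolding u_def using that False by (simp add: cINF_greatest)
      have "u (x \<oplus>\<^bsub>V\<^esub> y) \<le> u x + u y" if xy: "x \<in> carrier V" "y \<in> carrier V" for x y
      proof -
        have *: "u (x \<oplus>\<^bsub>V\<^esub> y) \<le> q x + r y" if qr: "q \<in> C" "r \<in> C" for q r
        proof -
          have "\<exists>s\<in>C. s x \<le> q x \<and> s y \<le> r y"
            using total[OF qr] qr unfolding P_def by (meson order_refl)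
          then obtain s where s: "s \<in> C" "s x \<le> q x" "s y \<le> r y"
            by blast
          have "u (x \<oplus>\<^bsub>V\<^esub> y) \<le> s (x \<oplus>\<^bsub>V\<^esub> y)"
            using s xy by (intro u_le) auto
          also have "\<dots> \<le> s x + s y"
            using CA[OF s(1)] xy by (intro sublinear_add) (auto simp: A_def)
          finally show ?thesis
            using s by simp
        qed
        have "u (x \<oplus>\<^bsub>V\<^esub> y) - u y \<le> q x" if "q \<in> C" for q
          using le_u[of y "u (x \<oplus>\<^bsub>V\<^esub> y) - q x"] *[OF that] xy
          by (simp add: diff_le_eq add.commute)
        then show ?thesis
          using le_u[of x "u (x \<oplus>\<^bsub>V\<^esub> y) - u y"] xy by (simp add: diff_le_eq)
      qed
      moreover have "u (c \<odot> x) \<le> c * u x" if "c > 0" "x \<in> carrier V" for c x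
      proof -
        have "(1 / c) * u (c \<odot> x) \<le> q x" if "q \<in> C" for q
          using u_le[OF that scale_closed, of x c] CA[OF that] sublinear_scale[of q x c] \<open>c > 0\<close>
            \<open>x \<in> carrier V\<close> by (simp add: A_def pos_divide_le_eq mult.commute)
        then have "(1 / c) * u (c \<odot> x) \<le> u x"
          using that by (intro le_u)
        then show ?thesis
          using \<open>c > 0\<close> by (simp add: pos_divide_le_eq mult.commute)
      qed
      ultimately have "sublinear u"
        by (simp add: sublinear_def)
      moreover have "u x \<le> p x" if "x \<in> carrier V" for x
        using False u_le[OF _ that] CA that unfolding A_def by (fastforce intro: order_trans)
      ultimately have "u \<in> A"
        by (simp add: A_def u_def)
      moreover have "P a u" if "a \<in> C" for a
        unfolding P_def using u_le[OF that] CA[OF that] by (auto simp: A_def u_def)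
      ultimately show ?thesis
        by blast
    qed
  qed
  then obtain q where q: "q \<in> A" and min: "\<And>r. r \<in> A \<Longrightarrow> P q r \<Longrightarrow> r = q"
    by blast
  have "r x = q x" if r: "sublinear r" "\<forall>x\<in>carrier V. r x \<le> q x" and x: "x \<in> carrier V" for r x
  proof -
    have "(\<lambda>x. if x \<in> carrier V then r x else 0) = q"
      using q r cut[OF r(1)] by (intro min) (auto simp: A_def P_def intro: order_trans)
    then show ?thesis
      using x by (metis (mono_tags, lifting))
  qed
  then show ?thesis
    using q by (auto simp: A_def)
qed

text \<open>
  Minimality is applied below \<open>shave p x0\<close> instead of \<open>p\<close>: this forces \<open>q (- x0) \<le> - p x0\<close>, that is,
  \<open>q x0 \<ge> p x0\<close>.
\<close>

theorem hahn_banach: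
  assumes p: "sublinear p" and x0: "x0 \<in> carrier V"
  shows "\<exists>q. linear_on_carrier q \<and> (\<forall>x\<in>carrier V. q x \<le> p x) \<and> p x0 \<le> q x0"
proof -
  obtain q where q: "sublinear q" and le: "\<And>x. x \<in> carrier V \<Longrightarrow> q x \<le> shave p x0 x"
    and min: "\<And>r x. sublinear r \<Longrightarrow> \<forall>x\<in>carrier V. r x \<le> q x \<Longrightarrow> x \<in> carrier V \<Longrightarrow> r x = q x"
    using exists_minimal_sublinear[OF sublinear_shave[OF p x0]] by blast
  have neg: "q ((-1) \<odot> x) = - q x" if x: "x \<in> carrier V" for x
  proof -
    have "shave q x ((-1) \<odot> x) = q ((-1) \<odot> x)"
      using q x by (intro min sublinear_shave) (auto simp: shave_le_self scale_closed)
    then show ?thesis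
      using shave_uminus_le[OF q x] sublinear_uminus[OF q x] by simp
  qed
  have add: "q (x \<oplus>\<^bsub>V\<^esub> y) = q x + q y" if "x \<in> carrier V" "y \<in> carrier V" for x y
  proof -
    have "q ((-1) \<odot> (x \<oplus>\<^bsub>V\<^esub> y)) \<le> q ((-1) \<odot> x) + q ((-1) \<odot> y)"
      using sublinear_add[OF q, of "(-1) \<odot> x" "(-1) \<odot> y"] that by (simp add: vector_simps)
    then show ?thesis
      using sublinear_add[OF q that] that by (simp add: neg)
  qed
  have scale: "q (c \<odot> x) = c * q x" if x: "x \<in> carrier V" for c x
  proof (cases "0 \<le> c")
    case True
    then show ?thesis
      using sublinear_scale[OF q x] by simp
  next
    case False
    have "q (c \<odot> x) = q ((-1) \<odot> ((- c) \<odot> x))"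
      using x by (simp add: scale_scale)
    also have "\<dots> = - ((- c) * q x)"
      using neg[OF scale_closed[OF x, of "- c"]] sublinear_scale[OF q x, of "- c"] False by simp
    finally show ?thesis
      by simp
  qed
  have "q ((-1) \<odot> x0) \<le> - p x0"
    using le[OF scale_closed[OF x0]] shave_uminus_le[OF p x0] order_trans by blast
  then have "p x0 \<le> q x0"
    using neg[OF x0] by simp
  moreover have "q x \<le> p x" if "x \<in> carrier V" for x
    using le[OF that] shave_le_self[OF p x0 that] by simp
  ultimately show ?thesis
    using add scale by (intro exI[of _ q]) (simp add: linear_on_carrier_def)
qed

end

sublocale locally_convex_space \<subseteq> real_module V ..

context locally_convex_space
begin

text \<open>
  The Minkowski functional of a neighbourhood \<open>W\<close> of zero is the infimum of all \<open>t > 0\<close> with \<open>v \<in> t W\<close>.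
  This set of scalars is nonempty because \<open>a v \<rightarrow> 0\<close> as \<open>a \<rightarrow> 0\<close>.
\<close>

definition minkowski_set :: "'v set \<Rightarrow> 'v \<Rightarrow> real set" where
  "minkowski_set W v = {t. 0 < t \<and> (1 / t) \<odot> v \<in> W}"

definition minkowski :: "'v set \<Rightarrow> 'v \<Rightarrow> real" where
  "minkowski W v = Inf (minkowski_set W v)"

lemma minkowski_set_nonempty:
  assumes W: "openin T W" "\<zero>\<^bsub>V\<^esub> \<in> W" and v: "v \<in> carrier V"
  shows "minkowski_set W v \<noteq> {}"
proof -
  have "continuous_map euclideanreal (prod_topology euclideanreal T) (\<lambda>a. (a, v))"
    using v by (simp add: continuous_map_pairwise o_def topspace_eq)
  from continuous_map_compose[OF this continuous_smult]
  have "continuous_map euclideanreal T (\<lambda>a. a \<odot> v)"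
    by (simp add: o_def)
  then have "open {a. a \<odot> v \<in> W}"
    using openin_continuous_map_preimage[OF _ W(1)] by fastforce
  moreover have "0 \<in> {a. a \<odot> v \<in> W}"
    using W v by (simp add: scale_zero)
  ultimately obtain e where e: "e > 0" "\<And>a. dist a 0 < e \<Longrightarrow> a \<odot> v \<in> W"
    unfolding open_dist by blast
  have "2 / e \<in> minkowski_set W v"
    using e(1) e(2)[of "e / 2"] by (simp add: minkowski_set_def)
  then show ?thesis
    by blast
qed

lemma minkowski_le: "t \<in> minkowski_set W v \<Longrightarrow> minkowski W v \<le> t"
  unfolding minkowski_def by (rule cInf_lower) (auto simp: minkowski_set_def bdd_below_def intro: less_imp_le)

lemma le_minkowski:
  assumes "openin T W" "\<zero>\<^bsub>V\<^esub> \<in> W" "v \<in> carrier V" "\<And>t. t \<in> minkowski_set W v \<Longrightarrow> B \<le> t"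
  shows "B \<le> minkowski W v"
  unfolding minkowski_def by (rule cInf_greatest) (use minkowski_set_nonempty assms in auto)

text \<open>
  If \<open>v \<in> s W\<close> and \<open>w \<in> t W\<close>, then \<open>(v + w)/(s + t)\<close> is the convex combination of \<open>v/s\<close> and \<open>w/t\<close> with
  weights \<open>s/(s + t)\<close> and \<open>t/(s + t)\<close>.
\<close>

lemma sublinear_minkowski:
  assumes W: "openin T W" "\<zero>\<^bsub>V\<^esub> \<in> W" "convex_in V W"
  shows "sublinear (minkowski W)"
  unfolding sublinear_def
proof (intro conjI ballI allI impI)
  fix v w assume v: "v \<in> carrier V" and w: "w \<in> carrier V"
  have *: "minkowski W (v \<oplus>\<^bsub>V\<^esub> w) \<le> s + t" if s: "s \<in> minkowski_set W v" and t: "t \<in> minkowski_set W w" for s t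
  proof -
    have pos: "0 < s" "0 < t" and mem: "(1 / s) \<odot> v \<in> W" "(1 / t) \<odot> w \<in> W"
      using s t by (auto simp: minkowski_set_def)
    have a: "t / (s + t) \<in> {0..1}" "1 - t / (s + t) = s / (s + t)"
      using pos by (auto simp: field_simps)
    have "segment_point V (t / (s + t)) ((1 / s) \<odot> v) ((1 / t) \<odot> w) \<in> W"
      using W(3) mem a(1) unfolding convex_in_def by blast
    moreover have "segment_point V (t / (s + t)) ((1 / s) \<odot> v) ((1 / t) \<odot> w) =
        (1 / (s + t)) \<odot> (v \<oplus>\<^bsub>V\<^esub> w)"
      using v w pos by (simp add: segment_point_def a(2) scale_scale scale_add_right)
    ultimately show ?thesis
      using pos by (intro minkowski_le) (simp add: minkowski_set_def)
  qed
  have "minkowski W (v \<oplus>\<^bsub>V\<^esub> w) - minkowski W w \<le> s" if "s \<in> minkowski_set W v" for s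
    using le_minkowski[OF W(1,2) w, of "minkowski W (v \<oplus>\<^bsub>V\<^esub> w) - s"] *[OF that]
    by (simp add: diff_le_eq add.commute)
  from le_minkowski[OF W(1,2) v this]
  show "minkowski W (v \<oplus>\<^bsub>V\<^esub> w) \<le> minkowski W v + minkowski W w"
    by simp
next
  fix c :: real and v assume c: "0 < c" and v: "v \<in> carrier V"
  have "(1 / c) * minkowski W (c \<odot> v) \<le> t" if "t \<in> minkowski_set W v" for t
  proof -
    have "c * t \<in> minkowski_set W (c \<odot> v)"
      using that c v by (simp add: minkowski_set_def scale_scale)
    from minkowski_le[OF this] show ?thesis
      using c by (simp add: pos_divide_le_eq mult.commute)
  qed
  from le_minkowski[OF W(1,2) v this] show "minkowski W (c \<odot> v) \<le> c * minkowski W v"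
    using c by (simp add: pos_divide_le_eq mult.commute)
qed

lemma minkowski_le_one:
  assumes "v \<in> W" "W \<subseteq> carrier V"
  shows "minkowski W v \<le> 1"
proof (rule minkowski_le)
  show "1 \<in> minkowski_set W v"
    using assms scale_one[of v] by (auto simp: minkowski_set_def)
qed

lemma one_le_minkowski:
  assumes W: "openin T W" "\<zero>\<^bsub>V\<^esub> \<in> W" "convex_in V W" and v: "v \<in> carrier V" "v \<notin> W"
  shows "1 \<le> minkowski W v"
proof (rule le_minkowski[OF W(1,2) v(1)])
  fix t assume t: "t \<in> minkowski_set W v"
  show "1 \<le> t"
  proof (rule ccontr)
    assume "\<not> 1 \<le> t"
    then have "segment_point V t \<zero>\<^bsub>V\<^esub> ((1 / t) \<odot> v) \<in> W"
      using W(2,3) t unfolding convex_in_def minkowski_set_def by auto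
    then show False
      using v t by (simp add: segment_point_def minkowski_set_def vector_simps)
  qed
qed

text \<open>
  If \<open>q \<le> 1\<close> on \<open>W\<close>, then \<open>\<bar>q y - q x\<bar> \<le> e/2\<close> as soon as both \<open>y - x\<close> and \<open>x - y\<close> lie in \<open>(e/2) W\<close>.
\<close>

lemma continuous_linear_functional:
  assumes q: "linear_on_carrier q" and W: "openin T W" "\<zero>\<^bsub>V\<^esub> \<in> W" and le: "\<And>v. v \<in> W \<Longrightarrow> q v \<le> 1"
  shows "continuous_map T euclideanreal q"
proof -
  have cont: "continuous_map T T (\<lambda>y. a \<odot> (y \<oplus>\<^bsub>V\<^esub> b))" if b: "b \<in> carrier V" for a b
  proof -
    have "continuous_map T (prod_topology T T) (\<lambda>y. (y, b))"
      using b by (simp add: continuous_map_pairwise o_def topspace_eq)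
    from continuous_map_compose[OF this continuous_add]
    have "continuous_map T (prod_topology euclideanreal T) (\<lambda>y. (a, y \<oplus>\<^bsub>V\<^esub> b))"
      by (simp add: continuous_map_pairwise o_def)
    from continuous_map_compose[OF this continuous_smult] show ?thesis
      by (simp add: o_def)
  qed
  have W_sub: "W \<subseteq> carrier V"
    using W(1) openin_subset topspace_eq by blast
  have "\<exists>U. openin T U \<and> x \<in> U \<and> (\<forall>y\<in>U. q y \<in> ball (q x) e)" if x: "x \<in> carrier V" and e: "e > 0" for x e
  proof -
    define N where "N a = {y \<in> topspace T. a \<odot> (y \<oplus>\<^bsub>V\<^esub> (-1) \<odot> x) \<in> W}" for a
    have N: "openin T (N a)" "x \<in> N a" for a
      using openin_continuous_map_preimage[OF cont[OF scale_closed[OF x]] W(1)] W(2) x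
      by (simp_all add: N_def topspace_eq add_uminus scale_zero_right)
    have qN: "a * (q y - q x) \<le> 1" if "y \<in> N a" for a y
    proof -
      have y: "y \<in> carrier V"
        using that by (simp add: N_def topspace_eq)
      have "q (a \<odot> (y \<oplus>\<^bsub>V\<^esub> (-1) \<odot> x)) = a * (q y - q x)"
        using q x y by (simp add: linear_on_carrier_def scale_closed)
      then show ?thesis
        using le that by (fastforce simp: N_def)
    qed
    have "q y \<in> ball (q x) e" if "y \<in> N (2 / e) \<inter> N (- (2 / e))" for y
      using qN[of y "2 / e"] qN[of y "- (2 / e)"] that e
      by (auto simp: dist_real_def field_simps abs_if)
    then show ?thesis
      using N by (intro exI[of _ "N (2 / e) \<inter> N (- (2 / e))"]) auto
  qed
  then show ?thesis
    using Met_TC.continuous_map_to_metric[of T q] by (simp add: topspace_eq)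
qed

text \<open>
  A convex neighbourhood \<open>W\<close> of zero that misses \<open>x - y\<close> has a Minkowski functional with value at least
  \<open>1\<close> there. A linear functional below it that attains this value is continuous and separates \<open>x\<close> from \<open>y\<close>.
\<close>

theorem separating_functional:
  assumes x: "x \<in> carrier V" and y: "y \<in> carrier V" and "x \<noteq> y"
  shows "\<exists>q. linear_on_carrier q \<and> continuous_map T euclideanreal q \<and> q x \<noteq> q y"
proof -
  define d where "d = x \<oplus>\<^bsub>V\<^esub> (-1) \<odot> y"
  have d: "d \<in> carrier V"
    using x y by (simp add: d_def scale_closed)
  have "d \<noteq> \<zero>\<^bsub>V\<^esub>"
  proof
    assume "d = \<zero>\<^bsub>V\<^esub>"
    moreover have "d \<oplus>\<^bsub>V\<^esub> y = x"
      using x y by (simp add: d_def M.a_assoc vector_simps)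
    ultimately show False
      using \<open>x \<noteq> y\<close> y by simp
  qed
  then obtain U where U: "openin T U" "\<zero>\<^bsub>V\<^esub> \<in> U" "d \<notin> U"
    using Hausdorff d unfolding Hausdorff_space_def topspace_eq disjnt_def
    by (metis IntI M.zero_closed empty_iff)
  then obtain W where W: "openin T W" "\<zero>\<^bsub>V\<^esub> \<in> W" "W \<subseteq> U" "convex_in V W"
    using locally_convex by blast
  obtain q where q: "linear_on_carrier q" "\<And>v. v \<in> carrier V \<Longrightarrow> q v \<le> minkowski W v"
      "minkowski W d \<le> q d"
    using hahn_banach[OF sublinear_minkowski[OF W(1,2,4)] d] by blast
  have "1 \<le> q d"
    using one_le_minkowski[OF W(1,2,4) d] q(3) U(3) W(3) by (meson order_trans subsetD)
  moreover have "q d = q x - q y"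
    using q(1) x y by (simp add: d_def linear_on_carrier_def scale_closed)
  moreover have "q v \<le> 1" if "v \<in> W" for v
    using minkowski_le_one[OF that] q(2)[of v] W(4) that by (fastforce simp: convex_in_def)
  ultimately show ?thesis
    using continuous_linear_functional[OF q(1) W(1,2)] q(1) by (intro exI[of _ q]) auto
qed

end

section \<open>Barycentres and fixed points\<close>

definition affine_functions :: "(real, 'v) module \<Rightarrow> 'v topology \<Rightarrow> 'v set \<Rightarrow> ('v \<Rightarrow> real) set" where
  "affine_functions V T Y = {h. continuous_map (subtopology T Y) euclideanreal h \<and>
     (\<forall>x\<in>Y. \<forall>y\<in>Y. \<forall>a\<in>{0..1}. h (segment_point V a x y) = (1 - a) * h x + a * h y)}"

lemma affine_functions_const: "(\<lambda>_. c) \<in> affine_functions V T Y"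
  by (simp add: affine_functions_def algebra_simps)

lemma affine_functions_add:
  assumes "g \<in> affine_functions V T Y" "h \<in> affine_functions V T Y"
  shows "(\<lambda>y. g y + h y) \<in> affine_functions V T Y"
  using assms by (auto simp: affine_functions_def algebra_simps intro!: continuous_map_add)

lemma affine_functions_scale:
  assumes "h \<in> affine_functions V T Y"
  shows "(\<lambda>y. c * h y) \<in> affine_functions V T Y"
  using assms by (simp add: affine_functions_def continuous_map_real_mult_left distrib_left mult.left_commute)

text \<open>
  A positive normalised linear functional on the continuous affine functions of a compact convex
  set. It is shown to be evaluation at a point, the barycentre of the functional.
\<close>

locale affine_mean =
  fixes V :: "(real, 'v) module" and T :: "'v topology" and Y :: "'v set"
    and \<Lambda> :: "('v \<Rightarrow> real) \<Rightarrow> real"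
  assumes convex: "convex_in V Y" and compact: "compactin T Y" and nonempty: "Y \<noteq> {}"
    and \<Lambda>_add: "\<And>g h. g \<in> affine_functions V T Y \<Longrightarrow> h \<in> affine_functions V T Y \<Longrightarrow>
      \<Lambda> (\<lambda>y. g y + h y) = \<Lambda> g + \<Lambda> h"
    and \<Lambda>_scale: "\<And>c h. h \<in> affine_functions V T Y \<Longrightarrow> \<Lambda> (\<lambda>y. c * h y) = c * \<Lambda> h"
    and \<Lambda>_nonneg: "\<And>h. h \<in> affine_functions V T Y \<Longrightarrow> (\<And>y. y \<in> Y \<Longrightarrow> 0 \<le> h y) \<Longrightarrow> 0 \<le> \<Lambda> h"
    and \<Lambda>_one: "\<Lambda> (\<lambda>_. 1) = 1"
begin

lemma topspace_Y: "topspace (subtopology T Y) = Y"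
  using compact compactin_subset_topspace by fastforce

lemma \<Lambda>_const: "\<Lambda> (\<lambda>_. c) = c"
  using \<Lambda>_scale[OF affine_functions_const[of 1], of c] \<Lambda>_one by simp

lemma \<Lambda>_lower_bound:
  assumes h: "h \<in> affine_functions V T Y" and le: "\<And>y. y \<in> Y \<Longrightarrow> b \<le> h y"
  shows "b \<le> \<Lambda> h"
proof -
  have "0 \<le> \<Lambda> (\<lambda>y. h y + - b)"
    using le by (intro \<Lambda>_nonneg affine_functions_add h affine_functions_const) simp
  then show ?thesis
    using \<Lambda>_add[OF h affine_functions_const, of "- b"] \<Lambda>_const by simp
qed

lemma \<Lambda>_sum:
  assumes "finite H" "H \<subseteq> affine_functions V T Y"
  shows "(\<lambda>y. \<Sum>h\<in>H. c h * h y) \<in> affine_functions V T Y \<and>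
    \<Lambda> (\<lambda>y. \<Sum>h\<in>H. c h * h y) = (\<Sum>h\<in>H. c h * \<Lambda> h)"
  using assms
proof (induction H rule: finite_induct)
  case empty
  then show ?case
    using affine_functions_const[of 0] \<Lambda>_const[of 0] by simp
next
  case (insert g H)
  then have g: "(\<lambda>y. c g * g y) \<in> affine_functions V T Y" "\<Lambda> (\<lambda>y. c g * g y) = c g * \<Lambda> g"
    using affine_functions_scale \<Lambda>_scale by auto
  then show ?case
    using insert affine_functions_add[OF g(1)] \<Lambda>_add[OF g(1)] by simp
qed

text \<open>
  For finitely many functions the point is a minimiser \<open>z\<close> of the sum of the squares of the
  \<open>h y - \<Lambda> h\<close>. With \<open>c h = h z - \<Lambda> h\<close>, the first variation towards any \<open>y \<in> Y\<close> is nonnegative, so the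
  affine function \<open>\<Sum> c h * h\<close> attains its minimum at \<open>z\<close>. Positivity bounds its image under \<open>\<Lambda>\<close> below by
  this minimum, that is, \<open>\<Sum> c h * (h z - \<Lambda> h) \<le> 0\<close>, and this sum is \<open>\<Sum> (c h)\<^sup>2\<close>.
\<close>

lemma finite_barycenter:
  assumes H: "finite H" "H \<subseteq> affine_functions V T Y"
  shows "\<exists>y\<in>Y. \<forall>h\<in>H. h y = \<Lambda> h"
proof -
  define D where "D y = (\<Sum>h\<in>H. (h y - \<Lambda> h)\<^sup>2)" for y
  have "continuous_map (subtopology T Y) euclideanreal D"
    unfolding D_def using H
    by (intro continuous_map_sum continuous_map_real_pow continuous_map_diff continuous_map_const[THEN iffD2])
      (auto simp: affine_functions_def)
  then have "compact (D ` Y)"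
    using image_compactin[of "subtopology T Y" Y euclideanreal D] compact
    by (simp add: compactin_subtopology)
  then obtain z where z: "z \<in> Y" "\<And>y. y \<in> Y \<Longrightarrow> D z \<le> D y"
    using compact_attains_inf[of "D ` Y"] nonempty by auto
  define c where "c h = h z - \<Lambda> h" for h
  have variation: "0 \<le> (\<Sum>h\<in>H. c h * (h y - h z))" if y: "y \<in> Y" for y
  proof -
    define B where "B = (\<Sum>h\<in>H. c h * (h y - h z))"
    define E where "E = (\<Sum>h\<in>H. (h y - h z)\<^sup>2)"
    have E: "0 \<le> E"
      unfolding E_def by (simp add: sum_nonneg)
    have step: "0 \<le> 2 * B + a * E" if a: "0 < a" "a \<le> 1" for a
    proof -
      have mem: "segment_point V a z y \<in> Y"
        using convex z(1) y a unfolding convex_in_def by simp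
      have h: "h (segment_point V a z y) - \<Lambda> h = c h + a * (h y - h z)" if "h \<in> H" for h
        using H(2) that z(1) y a by (auto simp: affine_functions_def c_def algebra_simps subset_iff)
      have "D z \<le> D (segment_point V a z y)"
        using z(2) mem by simp
      also have "\<dots> = (\<Sum>h\<in>H. (c h + a * (h y - h z))\<^sup>2)"
        unfolding D_def by (intro sum.cong refl) (simp add: h)
      also have "\<dots> = (\<Sum>h\<in>H. (c h)\<^sup>2 + 2 * a * (c h * (h y - h z)) + a\<^sup>2 * (h y - h z)\<^sup>2)"
        by (intro sum.cong refl) (simp add: power2_eq_square algebra_simps)
      also have "\<dots> = D z + 2 * a * B + a\<^sup>2 * E"
        by (simp add: D_def c_def B_def E_def sum.distrib sum_distrib_left)
      finally have "0 \<le> a * (2 * B + a * E)"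
        by (simp add: power2_eq_square algebra_simps)
      then show ?thesis
        using a(1) by (simp add: zero_le_mult_iff)
    qed
    have "0 \<le> B"
    proof (rule ccontr)
      assume "\<not> 0 \<le> B"
      \<comment> \<open>A step length for which the linear term dominates the quadratic one.\<close>
      define a where "a = min 1 (- B / (E + 1))"
      have "0 < - B / (E + 1)"
        using \<open>\<not> 0 \<le> B\<close> E by (intro divide_pos_pos) auto
      then have "0 < a" "a \<le> 1" "a \<le> - B / (E + 1)"
        by (auto simp: a_def)
      moreover from this(3) have "a * (E + 1) \<le> - B"
        using E by (simp only: pos_le_divide_eq[of "E + 1" a "- B"])
      ultimately show False
        using step[of a] \<open>\<not> 0 \<le> B\<close> by (simp add: algebra_simps)
    qed
    then show ?thesis
      by (simp add: B_def)
  qed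
  define s where "s y = (\<Sum>h\<in>H. c h * h y)" for y
  have s: "s \<in> affine_functions V T Y" "\<Lambda> s = (\<Sum>h\<in>H. c h * \<Lambda> h)"
    using \<Lambda>_sum[OF H, of c] by (auto simp: s_def[abs_def])
  have "s z \<le> \<Lambda> s"
    using variation by (intro \<Lambda>_lower_bound s) (simp add: s_def right_diff_distrib sum_subtractf)
  then have "(\<Sum>h\<in>H. (c h)\<^sup>2) \<le> 0"
    unfolding s(2) by (simp add: s_def c_def power2_eq_square right_diff_distrib sum_subtractf)
  then have "(\<Sum>h\<in>H. (c h)\<^sup>2) = 0"
    by (simp add: sum_nonneg antisym)
  then have "\<forall>h\<in>H. c h = 0"
    using H(1) by (simp add: sum_nonneg_eq_0_iff)
  then show ?thesis
    using z(1) by (auto simp: c_def)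
qed

text \<open>
  The sets \<open>{y \<in> Y. h y = \<Lambda> h}\<close> are closed and have the finite intersection property.
\<close>

theorem barycenter: "\<exists>y\<in>Y. \<forall>h\<in>affine_functions V T Y. h y = \<Lambda> h"
proof -
  let ?X = "subtopology T Y" and ?A = "affine_functions V T Y"
  define C where "C h = {y \<in> Y. h y = \<Lambda> h}" for h
  have "compact_space ?X"
    using compact by (rule compact_space_subtopology)
  moreover have "closedin ?X (C h)" if "h \<in> ?A" for h
  proof -
    have "C h = {y \<in> topspace ?X. h y \<in> {\<Lambda> h}}"
      unfolding topspace_Y by (simp add: C_def)
    moreover have "continuous_map ?X euclideanreal h"
      using that by (simp add: affine_functions_def)
    ultimately show ?thesis
      using closedin_continuous_map_preimage[of ?X euclideanreal h "{\<Lambda> h}"] by simp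
  qed
  moreover have "\<Inter>\<F> \<noteq> {}" if F: "finite \<F>" "\<F> \<subseteq> C ` ?A" for \<F>
  proof -
    obtain H where H: "finite H" "H \<subseteq> ?A" "\<F> = C ` H"
      using finite_subset_image[OF F] by blast
    obtain y where "y \<in> Y" "\<forall>h\<in>H. h y = \<Lambda> h"
      using finite_barycenter[OF H(1,2)] by blast
    then show ?thesis
      using H(3) by (auto simp: C_def)
  qed
  ultimately have "\<Inter>(C ` ?A) \<noteq> {}"
    unfolding compact_space_fip by (metis (no_types, lifting) imageE)
  then obtain y where "\<And>h. h \<in> ?A \<Longrightarrow> y \<in> C h"
    by blast
  then show ?thesis
    using affine_functions_const[of 0 V T Y] by (intro bexI[of _ y]) (auto simp: C_def)
qed

end

definition orbit_function :: "'a set \<Rightarrow> ('a \<Rightarrow> 'v \<Rightarrow> 'v) \<Rightarrow> 'v \<Rightarrow> ('v \<Rightarrow> real) \<Rightarrow> 'a \<Rightarrow> real" where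
  "orbit_function P act y h = (\<lambda>t. if t \<in> P then h (act t y) else 0)"

text \<open>
  The points \<open>u\<close> for which \<open>\<bar>h (u x) - h (s x)\<bar> < e\<close> holds for all \<open>x\<close> in the compact set \<open>Y\<close> include a
  neighbourhood of \<open>s\<close>, by the tube lemma. Applied to \<open>x = t y\<close>, this is the uniform estimate in \<open>t\<close> that
  the definition of \<open>RUC\<close> asks for.
\<close>

lemma orbit_function_RUC:
  fixes P :: "'a::topological_semigroup_mult set"
  assumes P: "subsemigroup P" and Y: "compactin T Y" and act: "continuous_affine_action P V T Y act"
    and y: "y \<in> Y" and h: "continuous_map (subtopology T Y) euclideanreal h"
  shows "orbit_function P act y h \<in> RUC_real P"
proof -
  let ?X = "subtopology T Y" and ?S = "top_of_set P"
  have cl: "\<And>s t. s \<in> P \<Longrightarrow> t \<in> P \<Longrightarrow> s * t \<in> P"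
    using P by (auto simp: subsemigroup_def)
  have top: "topspace ?X = Y"
    using Y compactin_subset_topspace by fastforce
  have act_cont: "continuous_map (prod_topology ?S ?X) ?X (\<lambda>(s, y). act s y)"
    and act_mult: "\<And>s t. s \<in> P \<Longrightarrow> t \<in> P \<Longrightarrow> act (s * t) y = act s (act t y)"
    using act y by (auto simp: continuous_affine_action_def)
  have act_Y: "act s x \<in> Y" if "s \<in> P" "x \<in> Y" for s x
    using continuous_map_image_subset_topspace[OF act_cont] that top by auto
  have g: "continuous_map (prod_topology ?S ?X) euclideanreal (\<lambda>p. h (act (fst p) (snd p)))"
    using continuous_map_compose[OF act_cont h] by (simp add: o_def case_prod_beta)
  have fix_left: "continuous_map (prod_topology ?S ?X) euclideanreal (\<lambda>p. h (act s (snd p)))"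
    if "s \<in> P" for s
  proof -
    have "continuous_map (prod_topology ?S ?X) (prod_topology ?S ?X) (\<lambda>p. (s, snd p))"
      using that by (simp add: continuous_map_pairwise o_def continuous_map_snd)
    from continuous_map_compose[OF this g] show ?thesis
      by (simp add: o_def)
  qed
  have fix_right: "continuous_map ?S euclideanreal (\<lambda>t. h (act t y))"
  proof -
    have "continuous_map ?S (prod_topology ?S ?X) (\<lambda>t. (t, y))"
      using y top by (simp add: continuous_map_pairwise o_def)
    from continuous_map_compose[OF this g] show ?thesis
      by (simp add: o_def)
  qed
  have cont: "continuous_on P (\<lambda>t. complex_of_real (orbit_function P act y h t))"
    using continuous_on_of_real[of P "\<lambda>t. h (act t y)"] fix_right
    by (simp add: orbit_function_def cong: continuous_on_cong)
  have "compact (h ` Y)"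
    using image_compactin[of ?X Y euclideanreal h] h Y by (simp add: compactin_subtopology)
  then obtain B where "\<And>x. x \<in> Y \<Longrightarrow> \<bar>h x\<bar> \<le> B"
    using compact_imp_bounded by (fastforce simp: bounded_iff)
  then have bdd: "bounded ((\<lambda>t. complex_of_real (orbit_function P act y h t)) ` P)"
    using act_Y y by (auto simp: bounded_iff orbit_function_def)
  have "\<exists>U. open U \<and> s \<in> U \<and> (\<forall>u\<in>U \<inter> P. \<forall>t\<in>P.
      \<bar>orbit_function P act y h (u * t) - orbit_function P act y h (s * t)\<bar> \<le> e)"
    if s: "s \<in> P" and e: "e > 0" for s e
  proof -
    define W where "W = {p \<in> topspace (prod_topology ?S ?X).
      h (act (fst p) (snd p)) - h (act s (snd p)) \<in> ball 0 e}"
    have "openin (prod_topology ?S ?X) W"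
      unfolding W_def
      by (rule openin_continuous_map_preimage[OF continuous_map_diff[OF g fix_left[OF s]]]) simp
    moreover have "compactin ?X Y"
      using Y by (simp add: compactin_subtopology)
    moreover have "{s} \<times> Y \<subseteq> W"
      using s e top by (auto simp: W_def)
    ultimately obtain U0 Z where U0: "openin ?S U0" "s \<in> U0" "Y \<subseteq> Z" "U0 \<times> Z \<subseteq> W"
      using tube_lemma_right[of ?S ?X W Y s] s by auto
    then obtain U where U: "open U" "U0 = P \<inter> U"
      by (auto simp: openin_open)
    have "\<bar>orbit_function P act y h (u * t) - orbit_function P act y h (s * t)\<bar> \<le> e"
      if "u \<in> U \<inter> P" "t \<in> P" for u t
    proof -
      have "(u, act t y) \<in> W"
        using U U0 that act_Y y by blast
      then show ?thesis
        using that s cl by (simp add: W_def orbit_function_def act_mult)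
    qed
    then show ?thesis
      using U U0(2) by blast
  qed
  then show ?thesis
    using cont bdd unfolding RUC_real_def RUC_iff[OF P] mem_Collect_eq of_real_diff[symmetric] norm_of_real
    by (simp add: orbit_function_def)
qed

text \<open>
  The fixed point is the barycentre of \<open>h \<mapsto> M (t \<mapsto> h (t y0))\<close>. Composing \<open>h\<close> with the action of \<open>s\<close>
  translates the orbit function by \<open>s\<close>, and \<open>M\<close> does not see this. The affine functions, rather than the
  linear ones alone, are needed because \<open>x \<mapsto> q (s x)\<close> is only affine and lives only on \<open>Y\<close>.
\<close>

theorem (in locally_convex_space) invariant_mean_imp_fixed_point:
  fixes P :: "'a::topological_semigroup_mult set"
  assumes P: "subsemigroup P" and M: "invariant_mean P M"
    and Y: "convex_in V Y" "compactin T Y" "Y \<noteq> {}"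
    and act: "continuous_affine_action P V T Y act"
  shows "\<exists>y\<in>Y. \<forall>s\<in>P. act s y = y"
proof -
  let ?X = "subtopology T Y" and ?A = "affine_functions V T Y"
  have cl: "\<And>s t. s \<in> P \<Longrightarrow> t \<in> P \<Longrightarrow> s * t \<in> P"
    using P by (auto simp: subsemigroup_def)
  have top: "topspace ?X = Y"
    using Y(2) compactin_subset_topspace by fastforce
  have act_cont: "continuous_map (prod_topology (top_of_set P) ?X) ?X (\<lambda>(s, y). act s y)"
    and act_mult: "\<And>s t y. s \<in> P \<Longrightarrow> t \<in> P \<Longrightarrow> y \<in> Y \<Longrightarrow> act (s * t) y = act s (act t y)"
    and act_affine: "\<And>s x y a. s \<in> P \<Longrightarrow> x \<in> Y \<Longrightarrow> y \<in> Y \<Longrightarrow> a \<in> {0..1} \<Longrightarrow>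
      act s (segment_point V a x y) = segment_point V a (act s x) (act s y)"
    using act unfolding continuous_affine_action_def by blast+
  have act_Y: "act s x \<in> Y" if "s \<in> P" "x \<in> Y" for s x
    using continuous_map_image_subset_topspace[OF act_cont] that top by auto
  obtain y0 where y0: "y0 \<in> Y"
    using Y(3) by blast
  define orb where "orb = orbit_function P act y0"
  have orb_mem: "orb h \<in> RUC_real P" if "h \<in> ?A" for h
    using orbit_function_RUC[OF P Y(2) act y0] that by (simp add: orb_def affine_functions_def)
  interpret affine_mean V T Y "\<lambda>h. M (orb h)"
  proof
    show "M (orb (\<lambda>_. 1)) = 1"
    proof -
      have "orb (\<lambda>_. 1) = indicator P"
        by (auto simp: orb_def orbit_function_def)
      then show ?thesis
        using M by (simp add: invariant_mean_def)
    qed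
  next
    fix g h assume "g \<in> ?A" "h \<in> ?A"
    moreover have "orb (\<lambda>y. g y + h y) = (\<lambda>t. orb g t + orb h t)"
      by (auto simp: orb_def orbit_function_def)
    ultimately show "M (orb (\<lambda>y. g y + h y)) = M (orb g) + M (orb h)"
      using M orb_mem by (simp add: invariant_mean_def)
  next
    fix c h assume "h \<in> ?A"
    moreover have "orb (\<lambda>y. c * h y) = (\<lambda>t. c * orb h t)"
      by (auto simp: orb_def orbit_function_def)
    ultimately show "M (orb (\<lambda>y. c * h y)) = c * M (orb h)"
      using M orb_mem by (simp add: invariant_mean_def)
  next
    fix h assume "h \<in> ?A" "\<And>y. y \<in> Y \<Longrightarrow> 0 \<le> h y"
    moreover from this have "0 \<le> orb h t" for t
      using act_Y y0 by (simp add: orb_def orbit_function_def)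
    ultimately show "0 \<le> M (orb h)"
      using M orb_mem by (simp add: invariant_mean_def)
  qed (use Y in auto)
  obtain y where y: "y \<in> Y" "\<And>h. h \<in> ?A \<Longrightarrow> h y = M (orb h)"
    using barycenter by blast
  have "act s y = y" if s: "s \<in> P" for s
  proof (rule ccontr)
    assume "act s y \<noteq> y"
    moreover have Y_sub: "Y \<subseteq> carrier V"
      using Y(1) by (simp add: convex_in_def)
    ultimately obtain q where q: "linear_on_carrier q" "continuous_map T euclideanreal q"
        "q (act s y) \<noteq> q y"
      using separating_functional[of "act s y" y] act_Y[OF s y(1)] y(1) by blast
    have qA: "q \<in> ?A"
      using q(1,2) Y_sub unfolding affine_functions_def
      by (auto simp: continuous_map_from_subtopology segment_point_def linear_on_carrier_def
          scale_closed subset_iff)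
    have "continuous_map ?X (prod_topology (top_of_set P) ?X) (\<lambda>x. (s, x))"
      using s by (simp add: continuous_map_pairwise o_def)
    from continuous_map_compose[OF this act_cont] have "continuous_map ?X ?X (act s)"
      by (simp add: o_def)
    from continuous_map_compose[OF this, of euclideanreal q]
    have "continuous_map ?X euclideanreal (\<lambda>x. q (act s x))"
      using qA by (simp add: affine_functions_def o_def)
    then have sA: "(\<lambda>x. q (act s x)) \<in> ?A"
      using qA act_affine[OF s] act_Y[OF s] by (simp add: affine_functions_def)
    have "orb (\<lambda>x. q (act s x)) = real_translate P (orb q) s"
      using cl s act_mult[OF s _ y0] by (auto simp: orb_def orbit_function_def real_translate_def)
    then have "q (act s y) = q y"
      using y(2)[OF sA] y(2)[OF qA] M orb_mem[OF qA] s by (simp add: invariant_mean_def)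
    then show False
      using q(3) by simp
  qed
  then show ?thesis
    using y(1) by blast
qed

section \<open>The compact convex set of unital contractions\<close>

text \<open>
  All complex functions on an index set, as a real vector space; \<open>euclidean\<close> is then the topology of
  pointwise convergence. The ring multiplication and unit of the record are those of the pointwise
  structure.
\<close>

definition function_module :: "(real, 'i \<Rightarrow> complex) module" where
  "function_module = \<lparr>carrier = UNIV, monoid.mult = (\<lambda>m n. \<lambda>i. m i * n i), one = (\<lambda>i. 1),
     ring.zero = (\<lambda>i. 0), add = (\<lambda>m n. \<lambda>i. m i + n i), smult = (\<lambda>a m. \<lambda>i. of_real a * m i)\<rparr>"

lemma function_module_simps [simp]:
  "carrier function_module = UNIV"
  "\<zero>\<^bsub>function_module\<^esub> = (\<lambda>i. 0)"
  "m \<oplus>\<^bsub>function_module\<^esub> n = (\<lambda>i. m i + n i)"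
  "a \<odot>\<^bsub>function_module\<^esub> m = (\<lambda>i. of_real a * m i)"
  by (simp_all add: function_module_def)

lemma segment_point_function_module:
  "segment_point function_module a m n = (\<lambda>i. of_real (1 - a) * m i + of_real a * n i)"
  by (simp add: segment_point_def)

lemma continuous_on_coordinate:
  fixes g :: "'b::topological_space \<Rightarrow> 'i \<Rightarrow> complex"
  shows "continuous_on A g \<Longrightarrow> continuous_on A (\<lambda>x. g x i)"
  by (rule continuous_on_product_then_coordinatewise)

theorem locally_convex_function_module:
  "locally_convex_space (function_module :: (real, 'i \<Rightarrow> complex) module) euclidean"
proof -
  let ?V = "function_module :: (real, 'i \<Rightarrow> complex) module"
  interpret Module.module "ring_of_type_algebra :: real ring" ?V
  proof (rule Module.moduleI)
    show "abelian_group ?V"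
    proof (rule abelian_groupI)
      fix m :: "'i \<Rightarrow> complex"
      show "\<exists>n\<in>carrier ?V. n \<oplus>\<^bsub>?V\<^esub> m = \<zero>\<^bsub>?V\<^esub>"
        by (intro bexI[of _ "\<lambda>i. - m i"]) auto
    qed (auto simp: algebra_simps)
  qed (auto simp: cring_real_ring ring_of_type_algebra_simps algebra_simps)
  show ?thesis
  proof
    show "topspace euclidean = carrier ?V"
      by simp
    show "Hausdorff_space (euclidean :: ('i \<Rightarrow> complex) topology)"
      by (simp flip: euclidean_product_topology add: Hausdorff_space_product_topology Hausdorff_space_euclidean)
    have "continuous_on UNIV (\<lambda>p. fst p \<oplus>\<^bsub>?V\<^esub> snd p)"
      unfolding function_module_simps
      by (rule continuous_on_coordinatewise_then_product)
        (intro continuous_on_add continuous_on_coordinate[OF continuous_on_fst[OF continuous_on_id]]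
          continuous_on_coordinate[OF continuous_on_snd[OF continuous_on_id]])
    then show "continuous_map (prod_topology euclidean euclidean) euclidean (\<lambda>(x, y). x \<oplus>\<^bsub>?V\<^esub> y)"
      by (simp add: case_prod_beta)
    have "continuous_on UNIV (\<lambda>p. fst p \<odot>\<^bsub>?V\<^esub> snd p)"
      unfolding function_module_simps
      by (rule continuous_on_coordinatewise_then_product)
        (intro continuous_on_mult continuous_on_of_real continuous_on_fst continuous_on_id
          continuous_on_coordinate[OF continuous_on_snd[OF continuous_on_id]])
    then show "continuous_map (prod_topology euclideanreal euclidean) euclidean (\<lambda>(a, x). a \<odot>\<^bsub>?V\<^esub> x)"
      by (simp add: case_prod_beta)
  next
    fix U :: "('i \<Rightarrow> complex) set"
    assume U: "openin euclidean U" "\<zero>\<^bsub>?V\<^esub> \<in> U"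
    obtain Z where Z: "(\<lambda>i. 0) \<in> Pi\<^sub>E UNIV Z" "\<And>i. open (Z i)"
        "finite {i. Z i \<noteq> UNIV}" "Pi\<^sub>E UNIV Z \<subseteq> U"
      using product_topology_open_contains_basis[of "\<lambda>i. euclidean" UNIV U "\<lambda>i. 0"] U
      by (auto simp: euclidean_product_topology)
    have "\<forall>i. \<exists>e>0. ball 0 e \<subseteq> Z i"
      using Z(1,2) open_contains_ball by (metis PiE_mem UNIV_I)
    then obtain e where e: "\<And>i. e i > 0" "\<And>i. ball 0 (e i) \<subseteq> Z i"
      by metis
    define J where "J = {i. Z i \<noteq> UNIV}"
    define W where "W = {m. \<forall>i\<in>J. m i \<in> ball (0::complex) (e i)}"
    have "openin euclidean W"
      using product_topology_basis'[of J "\<lambda>i. ball 0 (e i)" "\<lambda>i. i"] Z(3)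
      by (simp add: W_def J_def del: mem_ball mem_ball_0)
    moreover have "\<zero>\<^bsub>?V\<^esub> \<in> W"
      using e(1) by (simp add: W_def)
    moreover have "W \<subseteq> U"
    proof
      fix m assume "m \<in> W"
      then have "m i \<in> Z i" for i
        using e(2)[of i] by (cases "Z i = UNIV") (auto simp: W_def J_def simp del: mem_ball mem_ball_0)
      then show "m \<in> U"
        using Z(4) by blast
    qed
    moreover have "convex_in ?V W"
    proof -
      have "segment_point ?V a m n \<in> W" if "m \<in> W" "n \<in> W" "a \<in> {0..1}" for m n a
      proof -
        have "(1 - a) *\<^sub>R m i + a *\<^sub>R n i \<in> ball 0 (e i)" if "i \<in> J" for i
          using \<open>m \<in> W\<close> \<open>n \<in> W\<close> \<open>a \<in> {0..1}\<close> that
          by (intro convexD[OF convex_ball]) (auto simp: W_def)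
        then show ?thesis
          by (simp add: W_def segment_point_function_module scaleR_conv_of_real)
      qed
      then show ?thesis
        by (simp add: convex_in_def)
    qed
    ultimately show "\<exists>W. openin euclidean W \<and> \<zero>\<^bsub>?V\<^esub> \<in> W \<and> W \<subseteq> U \<and> convex_in ?V W"
      by blast
  qed
qed

text \<open>
  Functionals are extended by \<open>0\<close> from \<open>RUC P\<close> to all functions, so that distinct points of this set
  differ on \<open>RUC P\<close> and the set embeds in a product of discs. Contractions with value \<open>1\<close> at the constant
  function \<open>1\<close> are the means on \<open>RUC P\<close>.
\<close>

definition unital_contractions ::
    "'a::topological_semigroup_mult set \<Rightarrow> (('a \<Rightarrow> complex) \<Rightarrow> complex) set" where
  "unital_contractions P = {m.
     (\<forall>f. f \<notin> RUC P \<longrightarrow> m f = 0) \<and>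
     (\<forall>f\<in>RUC P. \<forall>g\<in>RUC P. m (\<lambda>t. f t + g t) = m f + m g) \<and>
     (\<forall>c. \<forall>f\<in>RUC P. m (\<lambda>t. c * f t) = c * m f) \<and>
     (\<forall>f\<in>RUC P. norm (m f) \<le> sup_norm P f) \<and>
     m (restrict_zero P (\<lambda>_. 1)) = 1}"

text \<open>
  A product of closed discs, compact by Tychonoff's theorem, intersected with the closed conditions
  of linearity and normalisation.
\<close>

lemma compact_unital_contractions: "compact (unital_contractions P)"
proof -
  define B where "B f = (if f \<in> RUC P then cball (0::complex) (sup_norm P f) else {0})" for f
  have "compactin (product_topology (\<lambda>f. euclidean) UNIV) (Pi\<^sub>E UNIV B)"
    unfolding compactin_PiE by (simp add: B_def)
  then have "compact (Pi\<^sub>E UNIV B)"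
    by (simp add: euclidean_product_topology)
  moreover have "closed (\<Inter>f\<in>RUC P. \<Inter>g\<in>RUC P. {m. m (\<lambda>t. f t + g t) = m f + (m g :: complex)})"
    by (intro closed_INT ballI closed_Collect_eq continuous_on_add continuous_on_product_coordinates)
  moreover have "closed (\<Inter>c. \<Inter>f\<in>RUC P. {m. m (\<lambda>t. c * f t) = c * (m f :: complex)})"
    by (intro closed_INT ballI closed_Collect_eq continuous_on_mult continuous_on_const
        continuous_on_product_coordinates)
  moreover have "closed {m. m (restrict_zero P (\<lambda>_. 1)) = (1::complex)}"
    by (intro closed_Collect_eq continuous_on_const continuous_on_product_coordinates)
  ultimately have "compact (Pi\<^sub>E UNIV B \<inter>
      (\<Inter>f\<in>RUC P. \<Inter>g\<in>RUC P. {m. m (\<lambda>t. f t + g t) = m f + m g}) \<inter>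
      (\<Inter>c. \<Inter>f\<in>RUC P. {m. m (\<lambda>t. c * f t) = c * m f}) \<inter>
      {m. m (restrict_zero P (\<lambda>_. 1)) = 1})"
    by (intro compact_Int_closed)
  moreover have "\<dots> = unital_contractions P"
    by (auto simp: unital_contractions_def B_def PiE_iff split: if_splits)
  ultimately show ?thesis
    by simp
qed

lemma unital_contractions_linear:
  assumes "m \<in> unital_contractions P" "f \<in> RUC P"
  shows unital_contractions_add: "g \<in> RUC P \<Longrightarrow> m (\<lambda>t. f t + g t) = m f + m g"
    and unital_contractions_scale: "m (\<lambda>t. c * f t) = c * m f"
    and unital_contractions_norm: "norm (m f) \<le> sup_norm P f"
  using assms by (simp_all add: unital_contractions_def)

lemma convex_unital_contractions: "convex_in function_module (unital_contractions P)"
proof -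
  have "segment_point function_module a m n \<in> unital_contractions P"
    if m: "m \<in> unital_contractions P" and n: "n \<in> unital_contractions P" and a: "a \<in> {0..1}" for m n a
  proof -
    have "norm (of_real (1 - a) * m f + of_real a * n f) \<le> sup_norm P f" if "f \<in> RUC P" for f
    proof -
      have "norm (of_real (1 - a) * m f + of_real a * n f) \<le> (1 - a) * norm (m f) + a * norm (n f)"
        using norm_triangle_ineq[of "of_real (1 - a) * m f" "of_real a * n f"] a
        by (simp add: norm_mult del: of_real_diff)
      also have "\<dots> \<le> (1 - a) * sup_norm P f + a * sup_norm P f"
        using m n a that by (intro add_mono mult_left_mono) (auto simp: unital_contractions_def)
      finally show ?thesis
        by (simp add: algebra_simps)
    qed
    then show ?thesis
      using m n by (simp add: segment_point_function_module unital_contractions_def algebra_simps)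
  qed
  then show ?thesis
    by (simp add: convex_in_def)
qed

text \<open>
  Point evaluations make the set of unital contractions nonempty.
\<close>

lemma evaluation_unital_contraction:
  assumes P: "subsemigroup P" and p: "p \<in> P"
  shows "(\<lambda>f. if f \<in> RUC P then f p else 0) \<in> unital_contractions P"
proof -
  have "norm (f p) \<le> sup_norm P f" if "f \<in> RUC P" for f
    using norm_le_sup_norm[OF p] that by (simp add: RUC_iff[OF P])
  then show ?thesis
    using RUC_add[OF P] RUC_scale[OF P] RUC_one[OF P] p
    by (simp add: unital_contractions_def restrict_zero_def)
qed

definition dual_action ::
    "'a::topological_semigroup_mult set \<Rightarrow> 'a \<Rightarrow> (('a \<Rightarrow> complex) \<Rightarrow> complex) \<Rightarrow> ('a \<Rightarrow> complex) \<Rightarrow> complex" where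
  "dual_action P s m = (\<lambda>f. if f \<in> RUC P then m (translate P f s) else 0)"

lemma dual_action_unital_contractions:
  assumes P: "subsemigroup P" and s: "s \<in> P" and m: "m \<in> unital_contractions P"
  shows "dual_action P s m \<in> unital_contractions P"
proof -
  have ne: "P \<noteq> {}" and cl: "\<And>s t. s \<in> P \<Longrightarrow> t \<in> P \<Longrightarrow> s * t \<in> P"
    using P by (auto simp: subsemigroup_def)
  have "translate P (\<lambda>t. f t + g t) s = (\<lambda>t. translate P f s t + translate P g s t)" for f g
    by (auto simp: translate_def restrict_zero_def)
  moreover have "translate P (\<lambda>t. c * f t) s = (\<lambda>t. c * translate P f s t)" for c f
    by (auto simp: translate_def restrict_zero_def)
  moreover have "translate P (restrict_zero P (\<lambda>_. 1)) s = restrict_zero P (\<lambda>_. 1)"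
    using cl s by (auto simp: translate_def restrict_zero_def)
  moreover have "norm (m (translate P f s)) \<le> sup_norm P f" if f: "f \<in> RUC P" for f
  proof -
    have "bounded (f ` P)" "bounded (translate P f s ` P)"
      using f RUC_translate[OF P f s] by (simp_all add: RUC_iff[OF P])
    then have "sup_norm P (translate P f s) \<le> sup_norm P f"
      using sup_norm_le_iff[OF ne, of "translate P f s"] norm_le_sup_norm[of _ P f] cl s
      by (simp add: translate_def restrict_zero_def)
    moreover have "norm (m (translate P f s)) \<le> sup_norm P (translate P f s)"
      using m RUC_translate[OF P f s] by (simp add: unital_contractions_def)
    ultimately show ?thesis
      by simp
  qed
  ultimately show ?thesis
    using m RUC_translate[OF P _ s] RUC_add[OF P] RUC_scale[OF P] RUC_one[OF P]
    by (simp add: unital_contractions_def dual_action_def)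
qed

text \<open>
  Joint continuity in \<open>(s, m)\<close>: \<open>m (f \<cdot> s)\<close> and \<open>n (f \<cdot> u)\<close> differ by at most
  \<open>\<bar>m (f \<cdot> s) - n (f \<cdot> s)\<bar> + \<parallel>f \<cdot> s - f \<cdot> u\<parallel>\<close>. The first term is small for \<open>n\<close> close to \<open>m\<close> at the single
  function \<open>f \<cdot> s\<close>, the second one by the definition of \<open>RUC\<close>, independently of \<open>n\<close>.
\<close>

lemma continuous_dual_action:
  assumes P: "subsemigroup P" and f: "f \<in> RUC P"
  shows "continuous_on (P \<times> unital_contractions P) (\<lambda>p. dual_action P (fst p) (snd p) f)"
proof -
  let ?Y = "unital_contractions P" and ?F = "\<lambda>p. dual_action P (fst p) (snd p) f"
  have ne: "P \<noteq> {}"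
    using P by (simp add: subsemigroup_def)
  have fb: "bounded (f ` P)"
    using f by (simp add: RUC_iff[OF P])
  have "\<exists>U. openin (top_of_set (P \<times> ?Y)) U \<and> (s, m) \<in> U \<and> (\<forall>q\<in>U. ?F q \<in> ball (?F (s, m)) e)"
    if s: "s \<in> P" and m: "m \<in> ?Y" and e: "e > 0" for s m e
  proof -
    have "e / 3 > 0"
      using e by simp
    from RUC_neighbourhood[OF P f s this] obtain U where U: "open U" "s \<in> U"
        "\<And>u t. u \<in> U \<Longrightarrow> u \<in> P \<Longrightarrow> t \<in> P \<Longrightarrow> norm (f (u * t) - f (s * t)) \<le> e / 3"
      by blast
    define N where "N = {n. n (translate P f s) \<in> ball (m (translate P f s)) (e / 3)}"
    have "open N"
      using product_topology_basis'[of "{()}" "\<lambda>_. ball (m (translate P f s)) (e / 3)"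
          "\<lambda>_. translate P f s"]
      by (simp add: N_def del: mem_ball)
    then have "openin (top_of_set (P \<times> ?Y)) ((P \<times> ?Y) \<inter> (U \<times> N))"
      using U(1) by (simp add: open_Times openin_open_Int)
    moreover have "(s, m) \<in> (P \<times> ?Y) \<inter> (U \<times> N)"
      using s m U e by (simp add: N_def)
    moreover have "?F q \<in> ball (?F (s, m)) e" if qU: "q \<in> (P \<times> ?Y) \<inter> (U \<times> N)" for q
    proof -
      obtain u n where q: "q = (u, n)" "u \<in> U \<inter> P" "n \<in> ?Y" "n \<in> N"
        using qU by (cases q) auto
      have g: "translate P f u \<in> RUC P" "translate P f s \<in> RUC P"
        using RUC_translate[OF P f] q s by auto
      then have g': "(\<lambda>t. (-1) * translate P f s t) \<in> RUC P"
        by (intro RUC_scale[OF P])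
      have "n (translate P f u) - n (translate P f s) =
          n (\<lambda>t. translate P f u t + (-1) * translate P f s t)"
      proof -
        have "n (\<lambda>t. translate P f u t + (-1) * translate P f s t) =
            n (translate P f u) + n (\<lambda>t. (-1) * translate P f s t)"
          using unital_contractions_add[OF q(3) g(1) g'] .
        also have "n (\<lambda>t. (-1) * translate P f s t) = (-1) * n (translate P f s)"
          by (rule unital_contractions_scale[OF q(3) g(2)])
        finally show ?thesis
          by simp
      qed
      also have "norm \<dots> \<le> sup_norm P (\<lambda>t. translate P f u t + (-1) * translate P f s t)"
        by (rule unital_contractions_norm[OF q(3) RUC_add[OF P g(1) g']])
      also have "\<dots> \<le> e / 3"
        using sup_norm_translate_diff_le_iff(1)[OF P fb _ s, of u "e / 3"] U(3) q(2) by simp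
      finally have "norm (n (translate P f u) - n (translate P f s)) \<le> e / 3" .
      moreover have "norm (m (translate P f s) - n (translate P f s)) < e / 3"
        using q(4) by (simp add: N_def dist_norm)
      moreover have "m (translate P f s) - n (translate P f u) =
          (m (translate P f s) - n (translate P f s)) - (n (translate P f u) - n (translate P f s))"
        by simp
      ultimately have "norm (m (translate P f s) - n (translate P f u)) < e"
        using norm_triangle_ineq4[of "m (translate P f s) - n (translate P f s)"
            "n (translate P f u) - n (translate P f s)"] e by (simp only:)
      then show ?thesis
        using f q(1) by (simp add: dual_action_def dist_norm)
    qed
    ultimately show ?thesis
      by blast
  qed
  then have "continuous_map (top_of_set (P \<times> ?Y)) euclidean ?F"
    using Met_TC.continuous_map_to_metric[of "top_of_set (P \<times> ?Y)" ?F] by auto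
  then show ?thesis
    by simp
qed

lemma continuous_affine_dual_action:
  assumes P: "subsemigroup P"
  shows "continuous_affine_action P function_module euclidean (unital_contractions P) (dual_action P)"
  unfolding continuous_affine_action_def
proof (intro conjI ballI)
  let ?Y = "unital_contractions P"
  have cl: "\<And>s t. s \<in> P \<Longrightarrow> t \<in> P \<Longrightarrow> s * t \<in> P"
    using P by (auto simp: subsemigroup_def)
  have "continuous_on (P \<times> ?Y) (\<lambda>p. dual_action P (fst p) (snd p))"
  proof (rule continuous_on_coordinatewise_then_product)
    fix f
    show "continuous_on (P \<times> ?Y) (\<lambda>p. dual_action P (fst p) (snd p) f)"
    proof (cases "f \<in> RUC P")
      case True
      then show ?thesis
        by (rule continuous_dual_action[OF P])
    qed (simp add: dual_action_def)
  qed
  then show "continuous_map (prod_topology (top_of_set P) (top_of_set ?Y)) (top_of_set ?Y)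
      (\<lambda>(s, m). dual_action P s m)"
    using dual_action_unital_contractions[OF P]
    by (auto simp: continuous_map_in_subtopology case_prod_beta)
  fix s assume s: "s \<in> P"
  show "dual_action P (s * t) m = dual_action P s (dual_action P t m)" if "t \<in> P" for t m
  proof -
    have "translate P (translate P f s) t = translate P f (s * t)" for f
      using cl that by (auto simp: translate_def restrict_zero_def mult.assoc)
    then show ?thesis
      using RUC_translate[OF P _ s] by (auto simp: dual_action_def)
  qed
  show "dual_action P s (segment_point function_module a m n) =
      segment_point function_module a (dual_action P s m) (dual_action P s n)" for m n a
    by (auto simp: dual_action_def segment_point_function_module)
qed

theorem fixed_point_property_imp_invariant_functional:
  fixes P :: "'a::topological_semigroup_mult set"
  assumes P: "subsemigroup P"
    and fpp: "fixed_point_property TYPE(('a \<Rightarrow> complex) \<Rightarrow> complex) P"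
  shows "\<exists>m. RUC_functional P m \<and> m (restrict_zero P (\<lambda>_. 1)) = 1 \<and> translation_invariant P m"
proof -
  obtain p where "p \<in> P"
    using P by (auto simp: subsemigroup_def)
  then have "unital_contractions P \<noteq> {}"
    using evaluation_unital_contraction[OF P] by blast
  then obtain m where m: "m \<in> unital_contractions P" "\<And>s. s \<in> P \<Longrightarrow> dual_action P s m = m"
    using fpp locally_convex_function_module convex_unital_contractions compact_unital_contractions
      continuous_affine_dual_action[OF P]
    unfolding fixed_point_property_def compactin_euclidean_iff[symmetric] by blast
  have "m (translate P f s) = m f" if "f \<in> RUC P" "s \<in> P" for f s
    using fun_cong[OF m(2)[OF that(2)], of f] that(1) by (simp add: dual_action_def)
  then have "translation_invariant P m"
    by (simp add: translation_invariant_def)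
  moreover have "\<forall>f\<in>RUC P. norm (m f) \<le> 1 * sup_norm P f"
    using m(1) by (simp add: unital_contractions_def)
  then have "RUC_functional P m"
    using m(1) unfolding RUC_functional_def unital_contractions_def by blast
  ultimately show ?thesis
    using m(1) by (auto simp: unital_contractions_def)
qed

section \<open>The equivalence\<close>

lemma subsemigroup_unit_fibre:
  fixes \<phi> :: "'a::topological_semigroup_mult \<Rightarrow> complex"
  assumes "semigroup_character \<phi>" "unit_fibre \<phi> \<noteq> {}"
  shows "subsemigroup (unit_fibre \<phi>)"
  using assms by (simp add: subsemigroup_def semigroup_character_def unit_fibre_def)

lemma restrict_zero_unit_fibre:
  "restrict_zero (unit_fibre \<phi>) \<phi> = restrict_zero (unit_fibre \<phi>) (\<lambda>_. 1)"
  by (auto simp: restrict_zero_def unit_fibre_def)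

theorem invariant_functional_imp_fixed_point_property:
  fixes P :: "'a::topological_semigroup_mult set"
  assumes P: "subsemigroup P" and m: "RUC_functional P m" "m (restrict_zero P (\<lambda>_. 1)) = 1"
      "translation_invariant P m"
  shows "fixed_point_property TYPE('v) P"
  unfolding fixed_point_property_def
  using invariant_functional_imp_mean[OF P m] locally_convex_space.invariant_mean_imp_fixed_point[OF _ P]
  by blast

theorem corollary5p2:
  fixes \<phi> :: "'a::topological_semigroup_mult \<Rightarrow> complex"
  assumes "semigroup_character \<phi>"
    and "unit_fibre \<phi> \<noteq> {}"
  shows "((\<exists>m. RUC_functional (unit_fibre \<phi>) m \<and>
              m (restrict_zero (unit_fibre \<phi>) \<phi>) = 1 \<and>
              translation_invariant (unit_fibre \<phi>) m)
          \<longleftrightarrow> fixed_point_property TYPE(('a \<Rightarrow> complex) \<Rightarrow> complex) (unit_fibre \<phi>))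
       \<and> ((\<exists>m. RUC_functional (unit_fibre \<phi>) m \<and>
              m (restrict_zero (unit_fibre \<phi>) \<phi>) = 1 \<and>
              translation_invariant (unit_fibre \<phi>) m)
          \<longrightarrow> fixed_point_property TYPE('v) (unit_fibre \<phi>))"
proof -
  let ?P = "unit_fibre \<phi>"
  have P: "subsemigroup ?P"
    by (rule subsemigroup_unit_fibre[OF assms])
  have forward: "(\<exists>m. RUC_functional ?P m \<and> m (restrict_zero ?P (\<lambda>_. 1)) = 1 \<and>
      translation_invariant ?P m) \<longrightarrow> fixed_point_property TYPE(('a \<Rightarrow> complex) \<Rightarrow> complex) ?P"
    by (intro impI, elim exE conjE) (rule invariant_functional_imp_fixed_point_property[OF P])
  have forward': "(\<exists>m. RUC_functional ?P m \<and> m (restrict_zero ?P (\<lambda>_. 1)) = 1 \<and>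
      translation_invariant ?P m) \<longrightarrow> fixed_point_property TYPE('v) ?P"
    by (intro impI, elim exE conjE) (rule invariant_functional_imp_fixed_point_property[OF P])
  show ?thesis
    unfolding restrict_zero_unit_fibre
    by (rule conjI[OF iffI[OF mp[OF forward] fixed_point_property_imp_invariant_functional[OF P]]
          forward'])
qed

end
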